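(* Let $p$ be an odd prime, $r,t$ positive integers with $t>4$, $q=p^r$ and $n=2t$. For $h\in\mathbb{F}_{q^n}$ with $h^{q^t+1}=-1$ let $\psi_{h,t}(x)= x^{q}+x^{q^{t-1}}-h^{1-q^{t+1}}x^{q^{t+1}}+h^{1-q^{2t-1}}x^{q^{2t-1}}$ and \[L_{h,t}=\{\langle (x,\psi_{h,t}(x))\rangle_{\mathbb{F}_{q^n}}: x\in\mathbb{F}_{q^n}^*\}\subseteq \mathrm{PG}(1,q^n).\] Then the number $M$ of $\mathrm{P\Gamma L}(2,q^n)$-inequivalent linear sets among the $L_{h,t}$ (with $h$ ranging over all $h\in\mathbb{F}_{q^n}$ with $h^{q^t+1}=-1$) satisfies \[M\geq\begin{cases}\left\lfloor\frac{q^t+1}{8rt}\right\rfloor, & t\not\equiv 2\pmod 4,\\[4pt] \left\lfloor\frac{q^t+1}{4rt(q^2+1)}\right\rfloor,& t\equiv 2\pmod 4.\end{cases}\]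
   Context: $\langle v\rangle_{\mathbb{F}_{q^n}}$ denotes the point of the projective line $\mathrm{PG}(1,q^n)$ determined by a nonzero vector $v\in\mathbb{F}_{q^n}^2$. Two point sets $L,L'$ of $\mathrm{PG}(1,q^n)$ are $\mathrm{P\Gamma L}(2,q^n)$-equivalent if there is a collineation $\varphi\in\mathrm{P\Gamma L}(2,q^n)$ with $L^\varphi=L'$. *)

theory Defs
  imports "HOL-Analysis.Cartesian_Space" "HOL-Computational_Algebra.Primes"
begin

definition field_automorphism :: "('a::field \<Rightarrow> 'a) \<Rightarrow> bool" where
  "field_automorphism \<sigma> \<longleftrightarrow>
     bij \<sigma> \<and> \<sigma> 1 = 1 \<and> (\<forall>a b. \<sigma> (a + b) = \<sigma> a + \<sigma> b) \<and> (\<forall>a b. \<sigma> (a * b) = \<sigma> a * \<sigma> b)"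

definition GammaL2 :: "('a::field ^ 2 \<Rightarrow> 'a ^ 2) set" where
  "GammaL2 = {f. bij f \<and> (\<forall>u v. f (u + v) = f u + f v) \<and>
     (\<exists>\<sigma>. field_automorphism \<sigma> \<and> (\<forall>c v. f (c *s v) = \<sigma> c *s f v))}"

definition PG1 :: "('a::field ^ 2) set set" where
  "PG1 = {U. vec.subspace U \<and> vec.dim U = 1}"

text \<open>For \<open>v \<noteq> 0\<close> this is the point of the projective line determined by \<open>v\<close>.\<close>

definition proj_point :: "'a::field ^ 2 \<Rightarrow> ('a ^ 2) set" where
  "proj_point v = vec.span {v}"

text \<open>Restricting to the projective line makes these collineations genuine functions on points,
  so that semilinear maps differing by a scalar give the same element.\<close>

definition PGammaL2 :: "(('a::field ^ 2) set \<Rightarrow> ('a ^ 2) set) set" where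
  "PGammaL2 = (\<lambda>f. restrict ((`) f) PG1) ` GammaL2"

definition PGammaL2_rel :: "(('a::field ^ 2) set set \<times> ('a ^ 2) set set) set" where
  "PGammaL2_rel = {(L, L'). L \<subseteq> PG1 \<and> L' \<subseteq> PG1 \<and> (\<exists>\<phi>\<in>PGammaL2. \<phi> ` L = L')}"

definition psi :: "nat \<Rightarrow> nat \<Rightarrow> 'a::field \<Rightarrow> 'a \<Rightarrow> 'a" where
  "psi q t h x = x ^ q + x ^ (q ^ (t - 1))
     - h powi (1 - int q ^ (t + 1)) * x ^ (q ^ (t + 1))
     + h powi (1 - int q ^ (2 * t - 1)) * x ^ (q ^ (2 * t - 1))"

definition linset :: "nat \<Rightarrow> nat \<Rightarrow> 'a::field \<Rightarrow> ('a ^ 2) set set" where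
  "linset q t h = {proj_point (vector [x, psi q t h x]) | x. x \<noteq> 0}"

definition num_inequivalent :: "('a::field ^ 2) set set set \<Rightarrow> nat" where
  "num_inequivalent \<L> = card (\<L> // PGammaL2_rel)"

lemma proj_point_in_PG1:
  assumes "v \<noteq> 0"
  shows "proj_point v \<in> PG1"
proof -
  have "vec.independent {v}" using assms by simp
  then have "vec.dim {v} = 1" using vec.dim_eq_card_independent by fastforce
  then show ?thesis by (simp add: PG1_def proj_point_def vec.dim_span)
qed

lemma linset_subset_PG1: "linset q t h \<subseteq> PG1"
proof -
  have "vector [x, y] \<noteq> (0 :: 'a::field ^ 2)" if "x \<noteq> 0" for x y :: 'a
    using that by (metis vector_2(1) zero_index)
  then show ?thesis unfolding linset_def using proj_point_in_PG1 by blast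
qed

lemma GammaL2_image_PG1:
  assumes f: "f \<in> GammaL2" and U: "U \<in> PG1"
  shows "f ` U \<in> PG1"
proof -
  obtain \<sigma> where \<sigma>: "field_automorphism \<sigma>" and sc: "\<And>c v. f (c *s v) = \<sigma> c *s f v"
    using f by (auto simp: GammaL2_def)
  have ad: "\<And>u v. f (u + v) = f u + f v" and bf: "bij f" using f by (auto simp: GammaL2_def)
  have f0: "f 0 = 0" using ad[of 0 0] by simp
  have sub: "vec.subspace U" and d: "vec.dim U = 1" using U by (auto simp: PG1_def)
  obtain B where B: "B \<subseteq> U" "vec.independent B" "U \<subseteq> vec.span B" "card B = 1"
    using vec.basis_exists[of U] d by metis
  then obtain v where v: "B = {v}" by (auto simp: card_1_singleton_iff)
  have "v \<noteq> 0" using B v vec.dependent_zero by blast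
  have "U = vec.span {v}" using B v sub by (metis vec.span_minimal subset_antisym)
  then have "f ` U = range (\<lambda>c. \<sigma> c *s f v)"
    by (simp add: vec.span_singleton image_image sc)
  also have "\<dots> = range (\<lambda>c. c *s f v)"
  proof -
    have "range \<sigma> = UNIV" using \<sigma> by (simp add: field_automorphism_def bij_is_surj)
    then show ?thesis using image_image[of "\<lambda>c. c *s f v" \<sigma> UNIV] by simp
  qed
  also have "\<dots> = proj_point (f v)"
    by (auto simp: proj_point_def vec.span_singleton)
  finally have "f ` U = proj_point (f v)" .
  moreover have "f v \<noteq> 0" using \<open>v \<noteq> 0\<close> f0 injD[OF bij_is_inj[OF bf], of v 0] by auto
  ultimately show ?thesis using proj_point_in_PG1 by metis
qed

lemma PGammaL2_rel_iff:
  fixes L L' :: "('a::field ^ 2) set set"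
  shows "(L, L') \<in> PGammaL2_rel \<longleftrightarrow> L \<subseteq> PG1 \<and> (\<exists>f\<in>GammaL2. L' = (\<lambda>P. f ` P) ` L)"
proof (cases "L \<subseteq> PG1")
  case True
  have r: "restrict ((`) f) PG1 ` L = (\<lambda>P. f ` P) ` L" for f :: "'a ^ 2 \<Rightarrow> 'a ^ 2"
    by (rule image_cong[OF refl]) (use True in \<open>simp add: restrict_def subset_iff\<close>)
  have i: "(\<lambda>P. f ` P) ` L \<subseteq> PG1" if "f \<in> GammaL2" for f :: "'a ^ 2 \<Rightarrow> 'a ^ 2"
    using True GammaL2_image_PG1[OF that] by blast
  have "(L, L') \<in> PGammaL2_rel \<longleftrightarrow> L' \<subseteq> PG1 \<and> (\<exists>f\<in>GammaL2. (\<lambda>P. f ` P) ` L = L')"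
    unfolding PGammaL2_rel_def PGammaL2_def mem_Collect_eq case_prod_conv bex_simps r
    using True by simp
  then show ?thesis using True i by metis
next
  case False
  then show ?thesis by (simp add: PGammaL2_rel_def)
qed

lemma field_automorphism_inv:
  assumes "field_automorphism \<sigma>"
  shows "field_automorphism (inv \<sigma>)"
proof -
  have b: "bij \<sigma>" using assms by (simp add: field_automorphism_def)
  note i = bij_is_inj[OF b] and s = surj_f_inv_f[OF bij_is_surj[OF b]]
  have one: "\<sigma> 1 = 1" and ad: "\<And>a b. \<sigma> (a + b) = \<sigma> a + \<sigma> b"
    and mu: "\<And>a b. \<sigma> (a * b) = \<sigma> a * \<sigma> b"
    using assms by (auto simp: field_automorphism_def)
  have "inv \<sigma> 1 = 1" using inv_f_f[OF i, of 1] one by simp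
  moreover have "inv \<sigma> (a + b) = inv \<sigma> a + inv \<sigma> b" for a b
    using inv_f_f[OF i, of "inv \<sigma> a + inv \<sigma> b"] by (simp add: ad s)
  moreover have "inv \<sigma> (a * b) = inv \<sigma> a * inv \<sigma> b" for a b
    using inv_f_f[OF i, of "inv \<sigma> a * inv \<sigma> b"] by (simp add: mu s)
  ultimately show ?thesis
    using bij_imp_bij_inv[OF b] by (simp add: field_automorphism_def)
qed

lemma GammaL2_id: "id \<in> GammaL2"
proof -
  have "field_automorphism (id :: 'a::field \<Rightarrow> 'a)" by (simp add: field_automorphism_def)
  then show ?thesis by (force simp: GammaL2_def)
qed

lemma GammaL2_comp:
  assumes "f \<in> GammaL2" "g \<in> GammaL2"
  shows "f \<circ> g \<in> GammaL2"
proof -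
  obtain \<sigma> \<tau> where "field_automorphism \<sigma>" "\<forall>c v. f (c *s v) = \<sigma> c *s f v"
    "field_automorphism \<tau>" "\<forall>c v. g (c *s v) = \<tau> c *s g v"
    using assms by (auto simp: GammaL2_def)
  moreover from this have "field_automorphism (\<sigma> \<circ> \<tau>)"
    by (auto simp: field_automorphism_def bij_comp)
  ultimately show ?thesis using assms
    by (auto simp: GammaL2_def bij_comp intro!: exI[of _ "\<sigma> \<circ> \<tau>"])
qed

lemma GammaL2_inv:
  assumes "f \<in> GammaL2"
  shows "inv f \<in> GammaL2"
proof -
  obtain \<sigma> where \<sigma>: "field_automorphism \<sigma>" and sc: "\<And>c v. f (c *s v) = \<sigma> c *s f v"
    using assms by (auto simp: GammaL2_def)
  have ad: "\<And>u v. f (u + v) = f u + f v" and b: "bij f" using assms by (auto simp: GammaL2_def)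
  note i = inv_f_f[OF bij_is_inj[OF b]] and s = surj_f_inv_f[OF bij_is_surj[OF b]]
  have s\<sigma>: "\<sigma> (inv \<sigma> c) = c" for c
    using \<sigma> by (simp add: field_automorphism_def bij_is_surj surj_f_inv_f)
  have "inv f (u + v) = inv f u + inv f v" for u v
    using i[of "inv f u + inv f v"] by (simp add: ad s)
  moreover have "inv f (c *s v) = inv \<sigma> c *s inv f v" for c v
    using i[of "inv \<sigma> c *s inv f v"] by (simp add: sc s s\<sigma>)
  ultimately show ?thesis
    using field_automorphism_inv[OF \<sigma>] bij_imp_bij_inv[OF b] by (auto simp: GammaL2_def)
qed

lemma equiv_PGammaL2_rel:
  "equiv (Pow PG1) (PGammaL2_rel :: (('a::field ^ 2) set set \<times> ('a ^ 2) set set) set)"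
proof (rule equivI)
  show "(PGammaL2_rel :: (('a ^ 2) set set \<times> _) set) \<subseteq> Pow PG1 \<times> Pow PG1" by (auto simp: PGammaL2_rel_def)
  show "refl_on (Pow PG1) (PGammaL2_rel :: (('a ^ 2) set set \<times> _) set)"
    by (intro refl_onI) (auto simp: PGammaL2_rel_iff intro!: bexI[OF _ GammaL2_id])
  show "sym (PGammaL2_rel :: (('a ^ 2) set set \<times> _) set)"
  proof (rule symI)
    fix L L' :: "('a ^ 2) set set"
    assume a: "(L, L') \<in> PGammaL2_rel"
    then obtain f where f: "f \<in> GammaL2" "L' = (\<lambda>P. f ` P) ` L" by (auto simp: PGammaL2_rel_iff)
    have "L' \<subseteq> PG1" using a by (simp add: PGammaL2_rel_def)
    have "inj f" using f by (auto simp: GammaL2_def bij_is_inj)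
    then have "L = (\<lambda>P. inv f ` P) ` L'" by (simp add: f image_image)
    then show "(L', L) \<in> PGammaL2_rel"
      using GammaL2_inv[OF f(1)] \<open>L' \<subseteq> PG1\<close> by (auto simp: PGammaL2_rel_iff)
  qed
  show "trans (PGammaL2_rel :: (('a ^ 2) set set \<times> _) set)"
  proof (rule transI)
    fix L L' L'' :: "('a ^ 2) set set"
    assume a: "(L, L') \<in> PGammaL2_rel" "(L', L'') \<in> PGammaL2_rel"
    then obtain f g where f: "f \<in> GammaL2" "L' = (\<lambda>P. f ` P) ` L"
      and g: "g \<in> GammaL2" "L'' = (\<lambda>P. g ` P) ` L'" by (auto simp: PGammaL2_rel_iff)
    have "L'' = (\<lambda>P. (g \<circ> f) ` P) ` L" by (simp add: f g image_image)
    moreover have "L \<subseteq> PG1" using a by (simp add: PGammaL2_rel_def)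
    ultimately show "(L, L'') \<in> PGammaL2_rel"
      unfolding PGammaL2_rel_iff using GammaL2_comp[OF g(1) f(1)] by blast
  qed
qed

end

theory Submission
  imports Defs "HOL-Computational_Algebra.Polynomial" "HOL-Combinatorics.Cycles"
begin

text \<open>
  Write \<open>x\<^sub>i\<close> for \<open>x\<close> raised to \<open>q ^ i\<close>, with \<open>i\<close> modulo \<open>2t\<close>. Since \<open>h\<^sub>t = -1/h\<close>,
  \<open>\<psi>\<^sub>h(x) = x\<^sub>1 + x\<^bsub>t-1\<^esub> + h h\<^sub>1 x\<^bsub>t+1\<^esub> + (h / h\<^bsub>-1\<^esub>) x\<^bsub>-1\<^esub>\<close>. A field automorphism only replaces \<open>h\<close> by
  one of its at most \<open>2rt\<close> conjugates, so let a linear map with matrix \<open>(a b; c d)\<close> send \<open>L\<^sub>h\<close> to \<open>L\<^sub>k\<close>.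
  Then the map \<open>F\<close> with \<open>F(a x + b \<psi>\<^sub>h(x)) = c x + d \<psi>\<^sub>h(x)\<close> is a \<open>q\<close>-polynomial with the same set of values
  \<open>F(x) / x\<close> as \<open>\<psi>\<^sub>k\<close>. Comparing the power sums of these values for the exponents \<open>1\<close>,
  \<open>1 + q ^ i\<close> and \<open>1 + q + q ^ i\<close> (as Csajbok, Marino and Polverino do) kills the coefficients of \<open>F\<close>
  at \<open>0, t, \<plusminus>2, t\<plusminus>2\<close> and determines the products of opposite coefficients at \<open>\<plusminus>1\<close> and \<open>t\<plusminus>1\<close>.
  Comparing coefficients in that identity then shows that \<open>a\<close> and \<open>d\<close> vanish together,
  and either way \<open>(k k\<^sub>2)\<^sup>2 = (h h\<^sub>2)\<^sup>2\<close>. Hence \<open>k / h\<close> is a root of unity of order dividing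
  \<open>2(q\<^sup>2 + 1)\<close>, and of order dividing 4 unless \<open>t \<equiv> 2\<close> modulo 4;
  this bounds the share of the \<open>q ^ t + 1\<close> values of \<open>h\<close> that one class can take.
\<close>

section \<open>Power sums and root counts in a finite field\<close>

text \<open>Translation by 1 permutes the field, so the ones added to its elements sum to 0.\<close>

lemma of_nat_CARD_eq_0: "of_nat CARD('a::{ring_1,finite}) = (0 :: 'a)"
proof -
  have "(\<Sum>x\<in>UNIV. x + 1) = (\<Sum>x\<in>UNIV. x :: 'a)"
    by (rule sum.reindex_bij_witness[of _ "\<lambda>x. x - 1" "\<lambda>x. x + 1"]) auto
  then show ?thesis by (simp add: sum.distrib)
qed

lemma card_Compl_0: "card (- {0::'a::{zero,finite}}) = CARD('a) - 1"
  by (simp add: Compl_eq_Diff_UNIV)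

lemma card_roots_power_le:
  fixes c :: "'a::field"
  assumes "m > 0"
  shows "card {x. x ^ m = c} \<le> m"
proof -
  let ?P = "monom 1 m - [:c:]"
  have "degree ?P = m"
    using assms by (subst diff_conv_add_uminus, subst degree_add_eq_left) (auto simp: degree_monom_eq)
  moreover from this have "?P \<noteq> 0" using assms by auto
  moreover have "{x. x ^ m = c} = {x. poly ?P x = 0}" by (auto simp: poly_monom)
  ultimately show ?thesis using card_poly_roots_bound[of ?P] by simp
qed

text \<open>Multiplication by \<open>x\<close> permutes the nonzero elements and hence preserves
  their nonzero product.\<close>

lemma power_CARD_minus_1:
  fixes x :: "'a::{field,finite}"
  assumes "x \<noteq> 0"
  shows "x ^ (CARD('a) - 1) = 1"
proof -
  have "(\<Prod>y\<in>-{0}. x * y) = (\<Prod>y\<in>-{0::'a}. y)"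
    by (rule prod.reindex_bij_witness[of _ "\<lambda>y. y / x" "\<lambda>y. x * y"]) (use assms in auto)
  then have "x ^ card (-{0::'a}) * (\<Prod>y\<in>-{0::'a}. y) = (\<Prod>y\<in>-{0::'a}. y)"
    by (simp add: prod.distrib)
  then show ?thesis by (simp add: card_Compl_0)
qed

lemma power_eq_power_mod:
  fixes x :: "'a::{field,finite}"
  assumes "x \<noteq> 0" "m mod (CARD('a) - 1) = e mod (CARD('a) - 1)"
  shows "x ^ m = x ^ e"
proof -
  have "x ^ m = x ^ (m mod (CARD('a) - 1))" for m
    using power_CARD_minus_1[OF assms(1)]
    by (metis mult_1 mult_div_mod_eq power_add power_mult power_one)
  then show ?thesis using assms(2) by metis
qed

text \<open>The quotient form allows a negative exponent \<open>m - e\<close>. For congruent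
  exponents every summand is 1. Otherwise some \<open>y\<close> has
  \<open>y ^ m \<noteq> y ^ e\<close>, and replacing \<open>x\<close> by \<open>y * x\<close>
  rescales the sum by a factor other than 1, so the sum is 0.\<close>

lemma sum_power_nonzero:
  fixes m e :: nat
  shows "(\<Sum>x\<in>-{0::'a::{field,finite}}. x ^ m * inverse x ^ e) =
    (if m mod (CARD('a) - 1) = e mod (CARD('a) - 1) then -1 else 0)"
    (is "?S = _")
proof (cases "m mod (CARD('a) - 1) = e mod (CARD('a) - 1)")
  case True
  have "?S = (\<Sum>x\<in>-{0::'a}. 1)"
    by (rule sum.cong) (use power_eq_power_mod[OF _ True] in \<open>auto simp: power_inverse\<close>)
  also have "\<dots> = of_nat CARD('a) - 1"
    by (simp add: card_Compl_0 of_nat_diff Suc_leI)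
  finally show ?thesis using True by (simp add: of_nat_CARD_eq_0)
next
  case False
  let ?N = "CARD('a) - 1"
  have N: "?N > 0"
  proof -
    have "card {0,1::'a} \<le> CARD('a)" by (rule card_mono) auto
    then show ?thesis by simp
  qed
  \<comment> \<open>Otherwise all nonzero elements would be roots of unity of an order smaller than
    their number.\<close>
  have ex: "\<exists>y::'a. y \<noteq> 0 \<and> y ^ m \<noteq> y ^ e" if "m mod ?N < e mod ?N" for m e
  proof (rule ccontr)
    assume *: "\<not> ?thesis"
    let ?d = "e mod ?N - m mod ?N"
    have "y ^ ?d = 1" if "y \<noteq> 0" for y :: 'a
    proof -
      have "y ^ (m mod ?N) = y ^ (e mod ?N)"
        using * that power_eq_power_mod[OF that, of "m mod ?N" m] power_eq_power_mod[OF that, of "e mod ?N" e]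
        by auto
      then show ?thesis using that \<open>m mod ?N < e mod ?N\<close> by (simp add: power_diff)
    qed
    then have "-{0} \<subseteq> {y::'a. y ^ ?d = 1}" by auto
    then have "?N \<le> card {y::'a. y ^ ?d = 1}"
      using card_mono[of "{y::'a. y ^ ?d = 1}" "-{0}"] by (simp add: card_Compl_0)
    also have "\<dots> \<le> ?d" by (rule card_roots_power_le) (use that in simp)
    also have "\<dots> < ?N" using N mod_less_divisor[OF N, of e] by linarith
    finally show False by simp
  qed
  obtain y :: 'a where y: "y \<noteq> 0" "y ^ m \<noteq> y ^ e"
    using ex[of m e] ex[of e m] False by (metis nat_neq_iff)
  have "?S = (\<Sum>x\<in>-{0::'a}. (y * x) ^ m * inverse (y * x) ^ e)"
    by (rule sum.reindex_bij_witness[of _ "\<lambda>x. y * x" "\<lambda>x. x / y"]) (use y in auto)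
  also have "\<dots> = (y ^ m * inverse y ^ e) * ?S"
    by (simp add: sum_distrib_left power_mult_distrib mult_ac)
  finally have "(y ^ m * inverse y ^ e - 1) * ?S = 0" by (simp add: algebra_simps)
  moreover have "y ^ m * inverse y ^ e \<noteq> 1" using y by (simp add: power_inverse field_simps)
  ultimately show ?thesis using False by auto
qed

lemma of_nat_card_additive_subgroup:
  fixes K :: "'a::{idom,finite} set"
  assumes "\<And>x y. x \<in> K \<Longrightarrow> y \<in> K \<Longrightarrow> x + y \<in> K" "\<And>x y. x \<in> K \<Longrightarrow> y \<in> K \<Longrightarrow> x - y \<in> K"
    and "z \<in> K" "z \<noteq> 0"
  shows "of_nat (card K) = (0 :: 'a)"
proof -
  have "(\<Sum>x\<in>K. x + z) = (\<Sum>x\<in>K. x)"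
    by (rule sum.reindex_bij_witness[of _ "\<lambda>x. x - z" "\<lambda>x. x + z"]) (use assms in auto)
  then have "of_nat (card K) * z = 0" by (simp add: sum.distrib)
  then show ?thesis using assms by simp
qed

text \<open>Grouping the nonzero \<open>x\<close> by the value of \<open>f x / x\<close>, each group is a nonzero subgroup
  without 0, so its size is \<open>-1\<close> in the field: the power sums only see the set of values.\<close>

lemma sum_ratio_additive:
  fixes f :: "'a::{field,finite} \<Rightarrow> 'a"
  assumes add: "\<And>x y. f (x + y) = f x + f y"
  shows "(\<Sum>x\<in>-{0}. (f x / x) ^ e) = - (\<Sum>m\<in>{f x / x | x. x \<noteq> 0}. m ^ e)"
proof -
  have f0: "f 0 = 0" using add[of 0 0] by (metis add.right_neutral add_left_cancel)
  have fm: "f (x - y) = f x - f y" for x y using add[of "x - y" y] by simp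
  let ?M = "(\<lambda>x. f x / x) ` (-{0})"
  have "(\<Sum>x\<in>-{0}. (f x / x) ^ e) = (\<Sum>m\<in>?M. \<Sum>x\<in>{x\<in>-{0}. f x / x = m}. (f x / x) ^ e)"
    by (rule sum.image_gen) simp
  also have "\<dots> = (\<Sum>m\<in>?M. - (m ^ e))"
  proof (rule sum.cong[OF refl])
    fix m assume "m \<in> ?M"
    then obtain z where z: "z \<noteq> 0" "f z / z = m" by auto
    let ?K = "{x. f x = m * x}"
    have K: "of_nat (card ?K) = (0::'a)"
      by (rule of_nat_card_additive_subgroup[of _ z])
        (use z in \<open>auto simp: add fm algebra_simps\<close>)
    have "{x\<in>-{0}. f x / x = m} = ?K - {0}" by (auto simp: field_simps)
    moreover have "card (?K - {0}) = card ?K - 1" by (simp add: f0)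
    moreover have "card ?K \<ge> 1" using f0 by (simp add: Suc_le_eq card_gt_0_iff) (metis mult_zero_right)
    ultimately have c: "of_nat (card {x\<in>-{0}. f x / x = m}) = (-1 :: 'a)"
      using K by (simp add: of_nat_diff)
    have "(\<Sum>x\<in>{x\<in>-{0}. f x / x = m}. (f x / x) ^ e) = (\<Sum>x\<in>{x\<in>-{0}. f x / x = m}. m ^ e)"
      by (rule sum.cong) auto
    then show "(\<Sum>x\<in>{x\<in>-{0}. f x / x = m}. (f x / x) ^ e) = - (m ^ e)"
      using c by simp
  qed
  also have "?M = {f x / x | x. x \<noteq> 0}" by auto
  finally show ?thesis by (simp add: sum_negf)
qed

section \<open>Uniqueness of sums of three powers of \<open>q\<close>\<close>

text \<open>Dividing by the smallest power present and reducing modulo \<open>q\<close> shows that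
  the least exponents agree; the other two follow in the same way. Equal exponents on the left need
  care: \<open>q dvd 2\<close> contradicts \<open>q \<ge> 3\<close>, and a carry from three equal
  powers with \<open>q = 3\<close> is excluded by size.\<close>

lemma three_powers_eq:
  fixes q :: nat
  assumes q: "q \<ge> 3" and ij: "i \<ge> j" "j \<ge> k" and ab: "a > b" "b > c"
    and eq: "q ^ i + q ^ j + q ^ k = q ^ a + q ^ b + q ^ c"
  shows "i = a \<and> j = b \<and> k = c"
proof -
  have cancel: "x = y" if "q ^ j * x = q ^ j * y" for j x y using that q by simp
  have two: "i = a \<and> j = b" if e: "q ^ i + q ^ j = q ^ a + q ^ b" and "i \<ge> j" "a > b" for i j a b
  proof -
    have "j = b"
    proof (cases j b rule: linorder_cases)
      case less
      have "q ^ i + q ^ j = q ^ j * (q ^ (i - j) + 1)"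
        using \<open>i \<ge> j\<close> by (simp add: algebra_simps flip: power_add)
      moreover have "q ^ a + q ^ b = q ^ j * (q ^ (a - j) + q ^ (b - j))"
        using less \<open>a > b\<close> by (simp add: algebra_simps flip: power_add)
      ultimately have "q ^ (i - j) + 1 = q ^ (a - j) + q ^ (b - j)" using e cancel by metis
      moreover have "q dvd q ^ (a - j) + q ^ (b - j)" using less \<open>a > b\<close> by (simp add: dvd_power)
      ultimately have d: "q dvd q ^ (i - j) + 1" by simp
      show ?thesis
      proof (cases "i = j")
        case True
        then have "q dvd 2" using d by (simp add: numeral_2_eq_2)
        then show ?thesis using q by (auto dest: dvd_imp_le)
      next
        case False
        then have "q dvd q ^ (i - j)" using \<open>i \<ge> j\<close> by (intro dvd_power) auto
        then have "q dvd 1" using d dvd_add_right_iff by blast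
        then show ?thesis using q by simp
      qed
    next
      case greater
      have "q ^ i + q ^ j = q ^ b * (q ^ (i - b) + q ^ (j - b))"
        using \<open>i \<ge> j\<close> greater by (simp add: algebra_simps flip: power_add)
      moreover have "q ^ a + q ^ b = q ^ b * (q ^ (a - b) + 1)"
        using \<open>a > b\<close> by (simp add: algebra_simps flip: power_add)
      ultimately have "q ^ (i - b) + q ^ (j - b) = q ^ (a - b) + 1" using e cancel by metis
      moreover have "q dvd q ^ (i - b) + q ^ (j - b)" using greater \<open>i \<ge> j\<close> by (simp add: dvd_power)
      moreover have "q dvd q ^ (a - b)" using \<open>a > b\<close> by (simp add: dvd_power)
      ultimately have "q dvd 1" using dvd_add_right_iff by metis
      then show ?thesis using q by simp
    qed simp
    then show ?thesis using e q by simp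
  qed
  have "k = c"
  proof (cases k c rule: linorder_cases)
    case greater
    have "q dvd q ^ (i - c) + q ^ (j - c) + q ^ (k - c)"
      using greater ij by (simp add: dvd_power)
    moreover have "q ^ i + q ^ j + q ^ k = q ^ c * (q ^ (i - c) + q ^ (j - c) + q ^ (k - c))"
      using ij greater by (simp add: algebra_simps flip: power_add)
    moreover have "q ^ a + q ^ b + q ^ c = q ^ c * ((q ^ (a - c) + q ^ (b - c)) + 1)"
      using ab by (simp add: algebra_simps flip: power_add)
    ultimately have "q dvd (q ^ (a - c) + q ^ (b - c)) + 1" using eq cancel by metis
    moreover have "q dvd q ^ (a - c) + q ^ (b - c)" using ab by (simp add: dvd_power)
    ultimately have "q dvd 1" using dvd_add_right_iff by metis
    then show ?thesis using q by simp
  next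
    case less
    have "q dvd q ^ (a - k) + q ^ (b - k) + q ^ (c - k)"
      using less ab by (simp add: dvd_power)
    moreover have "q ^ i + q ^ j + q ^ k = q ^ k * (q ^ (i - k) + q ^ (j - k) + 1)"
      using ij by (simp add: algebra_simps flip: power_add)
    moreover have r: "q ^ a + q ^ b + q ^ c = q ^ k * (q ^ (a - k) + q ^ (b - k) + q ^ (c - k))"
      using ab less by (simp add: algebra_simps flip: power_add)
    ultimately have e: "q ^ (i - k) + q ^ (j - k) + 1 = q ^ (a - k) + q ^ (b - k) + q ^ (c - k)"
      and d: "q dvd q ^ (i - k) + q ^ (j - k) + 1" using eq cancel by metis+
    show ?thesis
    proof (cases "j = k")
      case False
      then have "q dvd q ^ (i - k) + q ^ (j - k)" using ij by (simp add: dvd_power)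
      then have "q dvd 1" using d dvd_add_right_iff by blast
      then show ?thesis using q by simp
    next
      case j: True
      show ?thesis
      proof (cases "i = k")
        case False
        then have "q dvd q ^ (i - k)" using ij by (simp add: dvd_power)
        moreover have "q dvd q ^ (i - k) + 2" using d j by simp
        ultimately have "q dvd 2" using dvd_add_right_iff by metis
        then show ?thesis using q by (auto dest: dvd_imp_le)
      next
        case True
        have "q \<le> q ^ (a - k)" "q \<le> q ^ (b - k)" "q \<le> q ^ (c - k)"
          using less ab q by (auto intro!: self_le_power)
        moreover have "q ^ (a - k) + q ^ (b - k) + q ^ (c - k) = 3" using e True j by simp
        ultimately show ?thesis using q by linarith
      qed
    qed
  qed simp
  then show ?thesis using two[of i j a b] eq ij ab by auto
qed

lemma three_powers_cases:
  fixes q :: nat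
  assumes q: "q \<ge> 3" and ab: "a \<noteq> b" "a \<noteq> c" "b \<noteq> c"
    and eq: "q ^ i + q ^ j + q ^ k = q ^ a + q ^ b + q ^ c"
  shows "(i, j, k) \<in> {(a,b,c), (a,c,b), (b,a,c), (b,c,a), (c,a,b), (c,b,a)}"
proof -
  have sorted: "(i, j, k) \<in> {(a,b,c), (a,c,b), (b,a,c), (b,c,a), (c,a,b), (c,b,a)}"
    if "i \<ge> j" "j \<ge> k" and eq: "q ^ i + q ^ j + q ^ k = q ^ a + q ^ b + q ^ c" for i j k
  proof -
    note * = three_powers_eq[OF q that(1,2)]
    consider "a > b \<and> b > c" | "a > c \<and> c > b" | "b > a \<and> a > c" | "b > c \<and> c > a"
      | "c > a \<and> a > b" | "c > b \<and> b > a" using ab by linarith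
    then show ?thesis
      by cases (use *[of a b c] *[of a c b] *[of b a c] *[of b c a] *[of c a b] *[of c b a] eq in
        \<open>simp_all add: add_ac\<close>)
  qed
  consider "i \<ge> j \<and> j \<ge> k" | "i \<ge> k \<and> k \<ge> j" | "j \<ge> i \<and> i \<ge> k" | "j \<ge> k \<and> k \<ge> i"
    | "k \<ge> i \<and> i \<ge> j" | "k \<ge> j \<and> j \<ge> i" by linarith
  then show ?thesis
    by cases (use sorted[of i j k] sorted[of i k j] sorted[of j i k] sorted[of j k i]
      sorted[of k i j] sorted[of k j i] eq in \<open>auto simp add: add_ac\<close>)
qed

text \<open>Both sums lie between 3 and \<open>q ^ n\<close>, so they differ by less than the
  modulus and congruence forces equality.\<close>

lemma three_powers_mod_cases:
  fixes q :: nat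
  assumes q: "q \<ge> 3" and ab: "a \<noteq> b" "a \<noteq> c" "b \<noteq> c"
    and less: "i < n" "j < n" "k < n" "a < n" "b < n" "c < n"
    and eq: "(q ^ i + q ^ j + q ^ k) mod (q ^ n - 1) = (q ^ a + q ^ b + q ^ c) mod (q ^ n - 1)"
  shows "(i, j, k) \<in> {(a,b,c), (a,c,b), (b,a,c), (b,c,a), (c,a,b), (c,b,a)}"
proof -
  have bound: "3 \<le> q ^ i + q ^ j + q ^ k \<and> q ^ i + q ^ j + q ^ k \<le> q ^ n"
    if "i < n" "j < n" "k < n" for i j k
  proof -
    have "1 \<le> q ^ l" for l using q by simp
    then have 1: "1 \<le> q ^ i" "1 \<le> q ^ j" "1 \<le> q ^ k" by blast+
    have "q ^ l \<le> q ^ (n - 1)" if "l < n" for l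
      using that q by (intro power_increasing) auto
    then have "q ^ i \<le> q ^ (n - 1)" "q ^ j \<le> q ^ (n - 1)" "q ^ k \<le> q ^ (n - 1)" using that by blast+
    moreover have "3 * q ^ (n - 1) \<le> q * q ^ (n - 1)" using q by simp
    moreover have "q * q ^ (n - 1) = q ^ n" using that by (cases n) auto
    ultimately show ?thesis using 1 by linarith
  qed
  have same: "x = y" if "x mod N = y mod N" "3 \<le> x" "3 \<le> y" "x \<le> N + 1" "y \<le> N + 1" "x \<le> y" for x y N :: nat
  proof -
    have "N dvd y - x" using that mod_eq_dvd_iff_nat by metis
    then show ?thesis using that by (auto dest: dvd_imp_le)
  qed
  have "q ^ n \<ge> 1" using q by simp
  then have "q ^ i + q ^ j + q ^ k = q ^ a + q ^ b + q ^ c"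
    using bound[OF less(1-3)] bound[OF less(4-6)] eq
      same[of "q ^ i + q ^ j + q ^ k" "q ^ n - 1" "q ^ a + q ^ b + q ^ c"]
      same[of "q ^ a + q ^ b + q ^ c" "q ^ n - 1" "q ^ i + q ^ j + q ^ k"]
    by linarith
  then show ?thesis by (rule three_powers_cases[OF q ab])
qed

section \<open>Frobenius powers on the field of order \<open>q ^ (2 * t)\<close>\<close>

locale linset_field =
  fixes p r t q :: nat and ty :: "'a::{field,finite} itself"
  assumes prime_p: "prime p" and odd_p: "odd p" and r_pos: "r > 0" and t_gt: "t > 4"
    and q_eq: "q = p ^ r" and card_UNIV: "CARD('a) = q ^ (2 * t)"
begin

lemma q_ge: "q \<ge> 3"
proof -
  have "p \<ge> 3" using prime_p odd_p prime_ge_2_nat[of p] by (cases "p = 2") auto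
  moreover have "p ^ 1 \<le> p ^ r" using r_pos \<open>p \<ge> 3\<close> by (intro power_increasing) auto
  ultimately show ?thesis unfolding q_eq by simp
qed

lemma CHAR_eq: "CHAR('a) = p"
proof -
  have "of_nat (p ^ (r * (2 * t))) = (0 :: 'a)"
    using of_nat_CARD_eq_0[where 'a='a] by (simp add: card_UNIV q_eq flip: power_mult)
  then have "of_nat p = (0 :: 'a)" by simp
  then have "CHAR('a) dvd p" by (simp add: of_nat_eq_0_iff_char_dvd)
  then show ?thesis using prime_p CHAR_not_1' [where 'a='a] by (metis One_nat_def prime_nat_iff)
qed

lemma frobenius_add: "(x + y :: 'a) ^ p ^ m = x ^ p ^ m + y ^ p ^ m"
  by (rule freshmans_dream') (simp_all add: CHAR_eq prime_p)

text \<open>Integer indices modulo \<open>2 * t\<close> let \<open>Fr (- 1)\<close> denote the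
  inverse of the \<open>q\<close>-th power map, and they add under composition.\<close>

definition Fr :: "int \<Rightarrow> 'a \<Rightarrow> 'a" where
  "Fr i x = x ^ (q ^ nat (i mod int (2 * t)))"

lemma q_power: "q ^ m = p ^ (r * m)"
  by (simp add: q_eq power_mult)

lemma Fr_add: "Fr i (x + y) = Fr i x + Fr i y"
  unfolding Fr_def q_power by (rule frobenius_add)

lemma Fr_mult: "Fr i (x * y) = Fr i x * Fr i y"
  by (simp add: Fr_def power_mult_distrib)

lemma Fr_0 [simp]: "Fr i 0 = 0"
  using q_ge by (simp add: Fr_def)

lemma Fr_1 [simp]: "Fr i 1 = 1"
  by (simp add: Fr_def)

lemma Fr_eq_0_iff [simp]: "Fr i x = 0 \<longleftrightarrow> x = 0"
  using q_ge by (simp add: Fr_def)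

lemma Fr_uminus: "Fr i (- x) = - Fr i x"
  using Fr_add[of i x "- x"] by (simp add: eq_neg_iff_add_eq_0 add.commute)

lemma Fr_diff: "Fr i (x - y) = Fr i x - Fr i y"
  using Fr_add[of i x "- y"] by (simp add: Fr_uminus)

lemma Fr_inverse: "Fr i (inverse x) = inverse (Fr i x)"
  by (simp add: Fr_def power_inverse)

lemma Fr_divide: "Fr i (x / y) = Fr i x / Fr i y"
  by (simp add: Fr_def power_divide)

lemma Fr_power: "Fr i (x ^ m) = Fr i x ^ m"
  by (simp add: Fr_def mult.commute flip: power_mult)

lemma Fr_sum: "Fr i (sum f A) = (\<Sum>x\<in>A. Fr i (f x))"
  by (induction A rule: infinite_finite_induct) (simp_all add: Fr_add)

lemma Fr_index_0 [simp]: "Fr 0 x = x"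
  by (simp add: Fr_def)

lemma Fr_cong: "i mod int (2 * t) = j mod int (2 * t) \<Longrightarrow> Fr i x = Fr j x"
  by (simp add: Fr_def)

lemma power_CARD: "x ^ (q ^ (2 * t)) = (x :: 'a)"
proof (cases "x = 0")
  case False
  have "q ^ (2 * t) = Suc (CARD('a) - 1)" using q_ge by (simp add: card_UNIV)
  then show ?thesis using power_CARD_minus_1[OF False] by (metis mult.right_neutral power_Suc)
qed (use q_ge in simp)

lemma Fr_of_nat: "Fr (int m) x = x ^ (q ^ m)"
proof -
  have "x ^ (Q ^ l) = x" if "x ^ Q = x" for x :: 'a and Q l
    by (induction l) (simp_all add: that power_mult)
  from this[OF power_CARD]
  have "x ^ (q ^ (2 * t * (m div (2 * t)))) = x" for x :: 'a
    unfolding power_mult[of q "2 * t"] .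
  then have "x ^ (q ^ (2 * t * (m div (2 * t)) + m mod (2 * t))) = x ^ (q ^ (m mod (2 * t)))"
    unfolding power_add power_mult[of x] by metis
  then show ?thesis unfolding mult_div_mod_eq by (simp only: Fr_def zmod_int[symmetric] nat_int)
qed

lemma Fr_Fr: "Fr i (Fr j x) = Fr (i + j) x"
proof -
  let ?i = "nat (i mod int (2 * t))" and ?j = "nat (j mod int (2 * t))"
  have "Fr i (Fr j x) = x ^ (q ^ (?i + ?j))"
    by (simp add: Fr_def power_add mult.commute flip: power_mult)
  also have "\<dots> = Fr (int (?i + ?j)) x" by (rule Fr_of_nat[symmetric])
  also have "\<dots> = Fr (i + j) x" using t_gt by (intro Fr_cong) (simp add: mod_add_eq)
  finally show ?thesis .
qed

lemma bij_Fr: "bij (Fr i)"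
  by (rule bij_betw_byWitness[of _ "Fr (- i)"]) (auto simp: Fr_Fr)

section \<open>Orthogonality of Frobenius ratios and \<open>q\<close>-polynomials\<close>

text \<open>The powers \<open>q ^ l\<close> with \<open>l < 2 * t\<close> lie below
  \<open>q ^ (2 * t) - 1\<close>, so distinct ones are incongruent modulo that number.\<close>

lemma sum_Fr_ratio:
  "(\<Sum>x\<in>-{0}. Fr i x * inverse (Fr j x)) =
    (if i mod int (2 * t) = j mod int (2 * t) then -1 else 0)"
proof -
  let ?i = "nat (i mod int (2 * t))" and ?j = "nat (j mod int (2 * t))"
  have less: "q ^ l < q ^ (2 * t) - 1" if "l < 2 * t" for l
  proof -
    have "q ^ l \<le> q ^ (2 * t - 1)" using that q_ge by (intro power_increasing) auto
    moreover have "q ^ (2 * t) = q * q ^ (2 * t - 1)" using t_gt by (simp flip: power_Suc)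
    moreover have "q * q ^ (2 * t - 1) \<ge> 3 * q ^ (2 * t - 1)" using q_ge by simp
    moreover have "q ^ (2 * t - 1) \<ge> 1" using q_ge by simp
    ultimately show ?thesis by linarith
  qed
  have ij: "?i < 2 * t" "?j < 2 * t" using t_gt by (auto simp: nat_less_iff)
  have "q ^ ?i mod (q ^ (2 * t) - 1) = q ^ ?j mod (q ^ (2 * t) - 1) \<longleftrightarrow> q ^ ?i = q ^ ?j"
    using less[OF ij(1)] less[OF ij(2)] by simp
  also have "\<dots> \<longleftrightarrow> ?i = ?j" using q_ge by simp
  also have "\<dots> \<longleftrightarrow> i mod int (2 * t) = j mod int (2 * t)" using t_gt by (simp add: eq_nat_nat_iff)
  finally show ?thesis
    using sum_power_nonzero[where 'a='a, of "q ^ ?i" "q ^ ?j"]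
    by (simp add: Fr_def card_UNIV power_inverse)
qed

abbreviation I :: "int set" where "I \<equiv> {0..<int (2 * t)}"

lemma sum_Fr_ratio3:
  assumes "a \<noteq> b" "a \<noteq> c" "b \<noteq> c" "a \<in> I" "b \<in> I" "c \<in> I" "i \<in> I" "j \<in> I" "k \<in> I"
  shows "(\<Sum>x\<in>-{0}. (Fr i x * Fr j x * Fr k x) * inverse (Fr a x * Fr b x * Fr c x)) =
    (if (i, j, k) \<in> {(a,b,c), (a,c,b), (b,a,c), (b,c,a), (c,a,b), (c,b,a)} then -1 else 0)"
proof -
  have Fr: "Fr i x = x ^ (q ^ nat i)" if "i \<in> I" for i x using that by (simp add: Fr_def)
  have "(q ^ nat i + q ^ nat j + q ^ nat k) mod (q ^ (2 * t) - 1) =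
      (q ^ nat a + q ^ nat b + q ^ nat c) mod (q ^ (2 * t) - 1) \<longleftrightarrow>
    (i, j, k) \<in> {(a,b,c), (a,c,b), (b,a,c), (b,c,a), (c,a,b), (c,b,a)}" (is "?l = ?l' \<longleftrightarrow> ?r")
  proof
    assume l: "?l = ?l'"
    have "(nat i, nat j, nat k) \<in> {(nat a,nat b,nat c), (nat a,nat c,nat b), (nat b,nat a,nat c),
      (nat b,nat c,nat a), (nat c,nat a,nat b), (nat c,nat b,nat a)}"
      by (rule three_powers_mod_cases[OF q_ge _ _ _ _ _ _ _ _ _ l]) (use assms in auto)
    moreover have "nat x = nat y \<longleftrightarrow> x = y" if "x \<in> I" "y \<in> I" for x y
      using that by (auto simp: eq_nat_nat_iff)
    ultimately show ?r using assms by simp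
  next
    assume ?r
    then show "?l = ?l'" by (auto simp: add_ac)
  qed
  then show ?thesis
    using sum_power_nonzero[where 'a='a, of "q ^ nat i + q ^ nat j + q ^ nat k" "q ^ nat a + q ^ nat b + q ^ nat c"]
    unfolding Fr[OF assms(4)] Fr[OF assms(5)] Fr[OF assms(6)] Fr[OF assms(7)] Fr[OF assms(8)] Fr[OF assms(9)]
    by (simp add: card_UNIV power_inverse power_add)
qed

lemma sum_Fr_ratio2:
  assumes "a \<noteq> b" "a \<in> I" "b \<in> I" "i \<in> I" "j \<in> I"
  shows "(\<Sum>x\<in>-{0}. (Fr i x * Fr j x) * inverse (Fr a x * Fr b x)) =
    (if (i, j) \<in> {(a,b), (b,a)} then -1 else 0)"
proof -
  \<comment> \<open>A third index \<open>c\<close>, inserted in numerator and denominator, reduces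
    the claim to \<open>sum_Fr_ratio3\<close>.\<close>
  have "card {a, b} < card I" using t_gt assms by simp
  then obtain c where c: "c \<in> I" "c \<noteq> a" "c \<noteq> b"
    by (metis card_mono finite.emptyI finite_insert insertCI linorder_not_less subsetI)
  have "(\<Sum>x\<in>-{0}. (Fr i x * Fr j x) * inverse (Fr a x * Fr b x)) =
    (\<Sum>x\<in>-{0}. (Fr i x * Fr j x * Fr c x) * inverse (Fr a x * Fr b x * Fr c x))"
    by (rule sum.cong) auto
  then show ?thesis using sum_Fr_ratio3[of a b c i j c] assms c by auto
qed

text \<open>By orthogonality of the ratios \<open>Fr i x / Fr j x\<close>, this extracts from a \<open>q\<close>-polynomial the
  coefficient at exponent \<open>q ^ j\<close>; the index \<open>j\<close> may be any integer, read modulo \<open>2t\<close>.\<close>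

definition coef :: "('a \<Rightarrow> 'a) \<Rightarrow> int \<Rightarrow> 'a" where
  "coef F j = - (\<Sum>x\<in>-{0}. F x * inverse (Fr j x))"

definition linearized :: "('a \<Rightarrow> 'a) \<Rightarrow> bool" where
  "linearized F \<longleftrightarrow> (\<forall>x. F x = (\<Sum>i\<in>I. coef F i * Fr i x))"

lemma coef_cong: "i mod int (2 * t) = j mod int (2 * t) \<Longrightarrow> coef F i = coef F j"
  unfolding coef_def by (simp cong: Fr_cong add: Fr_def)

lemma coef_add: "coef (\<lambda>x. F x + G x) j = coef F j + coef G j"
  by (simp add: coef_def sum.distrib algebra_simps)

lemma coef_cmult: "coef (\<lambda>x. c * F x) j = c * coef F j"
  by (simp add: coef_def sum_distrib_left mult.assoc)

lemma coef_Fr: "coef (Fr i) j = (if i mod int (2 * t) = j mod int (2 * t) then 1 else 0)"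
  by (simp add: coef_def sum_Fr_ratio)

lemma coef_Fr_comp: "coef (\<lambda>x. Fr a (F x)) j = Fr a (coef F (j - a))"
  by (simp add: coef_def Fr_uminus Fr_sum Fr_mult Fr_inverse Fr_Fr)

text \<open>Substituting \<open>y = l * Fr s x\<close> turns the defining sum into one for
  \<open>F\<close>. The hypothesis \<open>F 0 = 0\<close> serves the case \<open>l = 0\<close>,
  where this substitution fails.\<close>

lemma coef_comp_monomial:
  assumes "F 0 = 0"
  shows "coef (\<lambda>x. F (l * Fr s x)) j = coef F (j - s) * Fr (j - s) l"
proof (cases "l = 0")
  case False
  have "(\<Sum>x\<in>-{0}. F (l * Fr s x) * inverse (Fr j x)) =
      (\<Sum>y\<in>-{0}. F y * inverse (Fr (j - s) (y / l)))"
    by (rule sum.reindex_bij_witness[of _ "\<lambda>y. Fr (- s) (y / l)" "\<lambda>x. l * Fr s x"])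
      (use False in \<open>auto simp: Fr_Fr\<close>)
  then show ?thesis by (simp add: coef_def Fr_divide Fr_mult Fr_inverse sum_distrib_left divide_inverse mult_ac)
qed (simp add: assms coef_def)

lemma linearized_monomial: "linearized (\<lambda>x. c * Fr i x)"
  unfolding linearized_def
proof
  fix x
  let ?i = "i mod int (2 * t)"
  have i: "?i \<in> I" using t_gt by simp
  have "(\<Sum>j\<in>I. coef (\<lambda>x. c * Fr i x) j * Fr j x) = (\<Sum>j\<in>I. if j = ?i then c * Fr i x else 0)"
    by (rule sum.cong) (auto simp: coef_cmult coef_Fr intro: Fr_cong)
  then show "c * Fr i x = (\<Sum>j\<in>I. coef (\<lambda>x. c * Fr i x) j * Fr j x)" using i by simp
qed

lemma linearized_add: "linearized F \<Longrightarrow> linearized G \<Longrightarrow> linearized (\<lambda>x. F x + G x)"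
  unfolding linearized_def coef_add distrib_right sum.distrib by (rule allI) (rule arg_cong2[of _ _ _ _ "(+)"]; blast)

lemma linearized_sum: "(\<And>i. i \<in> A \<Longrightarrow> linearized (F i)) \<Longrightarrow> linearized (\<lambda>x. \<Sum>i\<in>A. F i x)"
  by (induction A rule: infinite_finite_induct)
    (use linearized_monomial[of 0] in \<open>auto intro: linearized_add\<close>)

lemma linearized_expand: "linearized F \<Longrightarrow> F x = (\<Sum>i\<in>I. coef F i * Fr i x)"
  unfolding linearized_def by blast

lemma linearized_comp:
  assumes "linearized F" "linearized G"
  shows "linearized (\<lambda>x. F (G x))"
proof -
  have "F (G x) = (\<Sum>i\<in>I. \<Sum>j\<in>I. (coef F i * Fr i (coef G j)) * Fr (i + j) x)" for x
  proof -
    have "F (G x) = (\<Sum>i\<in>I. coef F i * Fr i (\<Sum>j\<in>I. coef G j * Fr j x))"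
      using linearized_expand[OF assms(1)] linearized_expand[OF assms(2)] by metis
    then show ?thesis by (simp only: Fr_sum Fr_mult Fr_Fr sum_distrib_left mult.assoc)
  qed
  then have *: "(\<lambda>x. F (G x)) = (\<lambda>x. \<Sum>i\<in>I. \<Sum>j\<in>I. (coef F i * Fr i (coef G j)) * Fr (i + j) x)" by blast
  show ?thesis unfolding * by (intro linearized_sum linearized_monomial)
qed

lemma linearized_funpow: "linearized F \<Longrightarrow> linearized (F ^^ m)"
proof (induction m)
  case 0
  then show ?case using linearized_monomial[of 1 0] by (simp add: id_def)
next
  case (Suc m)
  then show ?case using linearized_comp[of F "F ^^ m"] by (simp add: comp_def)
qed

lemma linearized_additive: "linearized F \<Longrightarrow> F (x + y) = F x + F y"
  by (simp add: linearized_expand Fr_add sum.distrib algebra_simps)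

text \<open>A permutation of a finite set has finite order, so the inverse is an iterate of
  \<open>F\<close>, and iterates of \<open>q\<close>-polynomials are
  \<open>q\<close>-polynomials.\<close>

lemma linearized_inv:
  assumes "linearized F" "bij F"
  shows "linearized (inv F)"
proof -
  have "permutation F" using assms(2) by (simp add: permutation)
  then obtain m where m: "F ^^ m = id" "m > 0" by (rule permutation_is_nilpotent)
  then have "F \<circ> F ^^ (m - 1) = id" by (metis Suc_pred' funpow.simps(2))
  then have "inv F = F ^^ (m - 1)" using assms(2) by (metis bij_is_inj comp_assoc id_comp inv_o_cancel comp_id)
  then show ?thesis using linearized_funpow[OF assms(1)] by simp
qed

section \<open>Dickson matrices and the power sums of \<open>F x / x\<close>\<close>

text \<open>Entry in row \<open>a\<close> and column \<open>i\<close> of the Dickson matrix of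
  \<open>F\<close>: the coefficient of \<open>Fr i x\<close> in \<open>Fr a (F x)\<close>.\<close>

abbreviation dickson :: "('a \<Rightarrow> 'a) \<Rightarrow> int \<Rightarrow> int \<Rightarrow> 'a" where
  "dickson F a i \<equiv> Fr a (coef F (i - a))"

lemma Fr_expand:
  assumes "linearized F"
  shows "Fr a (F x) = (\<Sum>i\<in>I. dickson F a i * Fr i x)"
proof -
  have "linearized (\<lambda>x. Fr a (F x))"
    using linearized_comp[OF _ assms, of "Fr a"] linearized_monomial[of 1 a] by simp
  then show ?thesis using linearized_expand[of "\<lambda>x. Fr a (F x)"] by (simp add: coef_Fr_comp)
qed

lemma ratio_power: "a \<in> I \<Longrightarrow> (y / x) ^ (q ^ nat a) = Fr a y * inverse (Fr a x)"
  by (simp add: Fr_def power_divide divide_inverse power_inverse power_mult_distrib)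

lemma sum_ratio1: "(\<Sum>x\<in>-{0}. (F x / x) ^ 1) = - coef F 0"
  by (simp add: coef_def divide_inverse)

text \<open>After expanding the product and swapping sums, orthogonality keeps only the permutations
  of \<open>(a, b)\<close>. Up to sign this is the permanent of a principal 2 by 2 block of the
  Dickson matrix.\<close>

lemma sum_ratio2:
  assumes F: "linearized F" and ab: "a \<noteq> b" "a \<in> I" "b \<in> I"
  shows "(\<Sum>x\<in>-{0}. (F x / x) ^ (q ^ nat a + q ^ nat b)) =
    - (dickson F a a * dickson F b b + dickson F a b * dickson F b a)"
proof -
  let ?P = "{(a, b), (b, a)}"
  have "(\<Sum>x\<in>-{0}. (F x / x) ^ (q ^ nat a + q ^ nat b)) =
    (\<Sum>x\<in>-{0}. Fr a (F x) * Fr b (F x) * inverse (Fr a x * Fr b x))"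
    using ab by (simp add: power_add ratio_power mult_ac)
  also have "\<dots> = (\<Sum>x\<in>-{0}. \<Sum>(i,j)\<in>I\<times>I. dickson F a i * dickson F b j *
      (Fr i x * Fr j x * inverse (Fr a x * Fr b x)))"
  proof (rule sum.cong[OF refl])
    fix x
    have "Fr a (F x) * Fr b (F x) =
      (\<Sum>(i,j)\<in>I\<times>I. (dickson F a i * Fr i x) * (dickson F b j * Fr j x))"
      unfolding Fr_expand[OF F] sum_product sum.cartesian_product ..
    then show "Fr a (F x) * Fr b (F x) * inverse (Fr a x * Fr b x) = (\<Sum>(i,j)\<in>I\<times>I. dickson F a i * dickson F b j *
      (Fr i x * Fr j x * inverse (Fr a x * Fr b x)))"
      by (simp add: sum_distrib_left mult_ac split_def)
  qed
  also have "\<dots> = (\<Sum>(i,j)\<in>I\<times>I. \<Sum>x\<in>-{0}. dickson F a i * dickson F b j *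
      (Fr i x * Fr j x * inverse (Fr a x * Fr b x)))"
    by (subst sum.swap) (simp add: split_def)
  also have "\<dots> = (\<Sum>z\<in>I\<times>I. if z \<in> ?P then - (dickson F a (fst z) * dickson F b (snd z)) else 0)"
  proof (rule sum.cong[OF refl])
    fix z assume "z \<in> I\<times>I"
    then obtain i j where z: "z = (i, j)" "i \<in> I" "j \<in> I" by auto
    show "(case z of (i,j) \<Rightarrow> \<Sum>x\<in>-{0}. dickson F a i * dickson F b j *
      (Fr i x * Fr j x * inverse (Fr a x * Fr b x)))
      = (if z \<in> ?P then - (dickson F a (fst z) * dickson F b (snd z)) else 0)"
      unfolding z(1) prod.case sum_distrib_left[symmetric] sum_Fr_ratio2[OF ab z(2-3)] fst_conv snd_conv
      by (cases "(i, j) \<in> ?P") (simp_all only: if_True if_False mult_minus1_right mult_zero_right)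
  qed
  also have "\<dots> = (\<Sum>z\<in>?P. - (dickson F a (fst z) * dickson F b (snd z)))"
    using ab by (subst sum.inter_restrict[symmetric]) (auto intro!: sum.cong)
  also have "\<dots> = - (dickson F a a * dickson F b b + dickson F a b * dickson F b a)"
    using ab by simp
  finally show ?thesis .
qed

text \<open>The same expansion gives the permanent of a principal 3 by 3 block. Its diagonal entries
  are conjugates of \<open>coef F 0\<close>, so only the two 3-cycles survive.\<close>

lemma sum_ratio3:
  assumes F: "linearized F" and ab: "a \<noteq> b" "a \<noteq> c" "b \<noteq> c" "a \<in> I" "b \<in> I" "c \<in> I"
    and diag: "coef F 0 = 0"
  shows "(\<Sum>x\<in>-{0}. (F x / x) ^ (q ^ nat a + q ^ nat b + q ^ nat c)) =
    - (dickson F a b * dickson F b c * dickson F c a + dickson F a c * dickson F b a * dickson F c b)"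
proof -
  let ?P = "{(a,b,c), (a,c,b), (b,a,c), (b,c,a), (c,a,b), (c,b,a)}"
  let ?D = "\<lambda>(i,j,k). dickson F a i * dickson F b j * dickson F c k"
  have "(\<Sum>x\<in>-{0}. (F x / x) ^ (q ^ nat a + q ^ nat b + q ^ nat c)) =
    (\<Sum>x\<in>-{0}. Fr a (F x) * Fr b (F x) * Fr c (F x) * inverse (Fr a x * Fr b x * Fr c x))"
    using ab by (simp add: power_add ratio_power mult_ac)
  also have "\<dots> = (\<Sum>x\<in>-{0}. \<Sum>(i,j,k)\<in>I\<times>I\<times>I. dickson F a i * dickson F b j * dickson F c k *
      (Fr i x * Fr j x * Fr k x * inverse (Fr a x * Fr b x * Fr c x)))"
  proof (rule sum.cong[OF refl])
    fix x
    have "Fr a (F x) * (Fr b (F x) * Fr c (F x)) = (\<Sum>(i,j,k)\<in>I\<times>I\<times>I.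
        (dickson F a i * Fr i x) * ((dickson F b j * Fr j x) * (dickson F c k * Fr k x)))"
      unfolding Fr_expand[OF F] sum_product sum.cartesian_product split_def fst_conv snd_conv ..
    then show "Fr a (F x) * Fr b (F x) * Fr c (F x) * inverse (Fr a x * Fr b x * Fr c x) =
      (\<Sum>(i,j,k)\<in>I\<times>I\<times>I. dickson F a i * dickson F b j * dickson F c k *
        (Fr i x * Fr j x * Fr k x * inverse (Fr a x * Fr b x * Fr c x)))"
      by (simp add: sum_distrib_left mult_ac split_def)
  qed
  also have "\<dots> = (\<Sum>(i,j,k)\<in>I\<times>I\<times>I. \<Sum>x\<in>-{0}. dickson F a i * dickson F b j * dickson F c k *
      (Fr i x * Fr j x * Fr k x * inverse (Fr a x * Fr b x * Fr c x)))"
    by (subst sum.swap) (simp add: split_def)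
  also have "\<dots> = (\<Sum>z\<in>I\<times>I\<times>I. if z \<in> ?P then - ?D z else 0)"
  proof (rule sum.cong[OF refl])
    fix z assume "z \<in> I\<times>I\<times>I"
    then obtain i j k where z: "z = (i, j, k)" "i \<in> I" "j \<in> I" "k \<in> I" by auto
    show "(case z of (i,j,k) \<Rightarrow> \<Sum>x\<in>-{0}. dickson F a i * dickson F b j * dickson F c k *
      (Fr i x * Fr j x * Fr k x * inverse (Fr a x * Fr b x * Fr c x))) = (if z \<in> ?P then - ?D z else 0)"
      unfolding z(1) prod.case sum_distrib_left[symmetric] sum_Fr_ratio3[OF ab z(2-4)]
      by (cases "(i, j, k) \<in> ?P") (simp_all only: if_True if_False mult_minus1_right mult_zero_right)
  qed
  also have "\<dots> = (\<Sum>z\<in>?P. - ?D z)"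
    using ab by (subst sum.inter_restrict[symmetric]) (auto intro!: sum.cong)
  also have "\<dots> = - (dickson F a b * dickson F b c * dickson F c a + dickson F a c * dickson F b a * dickson F c b)"
    using ab diag by simp
  finally show ?thesis .
qed

section \<open>Two \<open>q\<close>-polynomials with the same set of ratios\<close>

context
  fixes F G
  assumes F: "linearized F" and G: "linearized G"
    and same: "{F x / x | x. x \<noteq> 0} = {G x / x | x. x \<noteq> 0}"
begin

lemma same_power_sums: "(\<Sum>x\<in>-{0}. (F x / x) ^ e) = (\<Sum>x\<in>-{0}. (G x / x) ^ e)"
  using sum_ratio_additive[of F, OF linearized_additive[OF F]]
    sum_ratio_additive[of G, OF linearized_additive[OF G]] same by simp

lemma same_coef_0: "coef F 0 = coef G 0"
  using same_power_sums[of 1] unfolding sum_ratio1 by simp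

text \<open>This is the exponent \<open>1 + q ^ k\<close>; the zero diagonal leaves only the product
  of opposite coefficients.\<close>

lemma same_coef_pair:
  assumes "coef G 0 = 0" "0 < k" "k < 2 * int t"
  shows "coef F k * Fr k (coef F (- k)) = coef G k * Fr k (coef G (- k))"
  using same_power_sums[of "q ^ nat 0 + q ^ nat k"] assms same_coef_0
    sum_ratio2[OF F, of 0 k] sum_ratio2[OF G, of 0 k]
  by simp

text \<open>This is the exponent \<open>1 + q + q ^ k\<close>. It separates the coefficients at
  \<open>k\<close> and \<open>- k\<close>, of which \<open>same_coef_pair\<close> sees only the
  product.\<close>

lemma same_coef_triple:
  assumes "coef G 0 = 0" "1 < k" "k < 2 * int t"
  shows "coef F 1 * Fr 1 (coef F (k - 1)) * Fr k (coef F (- k)) + coef F k * Fr k (coef F (1 - k)) * Fr 1 (coef F (- 1))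
    = coef G 1 * Fr 1 (coef G (k - 1)) * Fr k (coef G (- k)) + coef G k * Fr k (coef G (1 - k)) * Fr 1 (coef G (- 1))"
proof -
  have "coef F 0 = 0" using assms same_coef_0 by simp
  from sum_ratio3[OF F _ _ _ _ _ _ this, of 0 1 k] sum_ratio3[OF G _ _ _ _ _ _ assms(1), of 0 1 k]
  have "- (dickson F 0 1 * dickson F 1 k * dickson F k 0 + dickson F 0 k * dickson F 1 0 * dickson F k 1)
    = - (dickson G 0 1 * dickson G 1 k * dickson G k 0 + dickson G 0 k * dickson G 1 0 * dickson G k 1)"
    using same_power_sums[of "q ^ nat 0 + q ^ nat 1 + q ^ nat k"] assms t_gt
    by (simp del: minus_add_distrib)
  then show ?thesis unfolding neg_equal_iff_equal by (simp add: mult_ac)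
qed

end

section \<open>The polynomials \<open>psi\<close> and their coefficients\<close>

lemma mod_eq_iff: "\<bar>i - j\<bar> < 2 * int t \<Longrightarrow> i mod int (2 * t) = j mod int (2 * t) \<longleftrightarrow> i = j"
  using zdvd_imp_le[of "int (2 * t)" "\<bar>i - j\<bar>"] by (auto simp: mod_eq_dvd_iff)

lemma Fr_add_t:
  assumes "x ^ (q ^ t + 1) = - 1"
  shows "Fr (i + int t) x = - inverse (Fr i x)"
proof -
  have "Fr (int t) x * x = - 1" using assms by (simp add: Fr_of_nat mult.commute)
  then have "Fr (int t) x = - inverse x" using inverse_unique[of x "- Fr (int t) x"] by (simp add: mult.commute)
  then have "Fr i (Fr (int t) x) = - inverse (Fr i x)" by (simp add: Fr_uminus Fr_inverse)
  then show ?thesis by (simp add: Fr_Fr)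
qed

lemma psi_eq:
  assumes h: "h ^ (q ^ t + 1) = - 1"
  shows "psi q t h x = Fr 1 x + Fr (int t - 1) x + h * Fr 1 h * Fr (int t + 1) x + h / Fr (- 1) h * Fr (- 1) x"
proof -
  have h0: "h \<noteq> 0" using h by auto
  have last: "y ^ (q ^ (2 * t - 1)) = Fr (- 1) y" for y :: 'a
    using t_gt by (subst Fr_of_nat[symmetric], intro Fr_cong) (simp add: of_nat_diff mod_diff_left_eq[symmetric])
  have powi: "h powi (1 - int q ^ m) = h / h ^ (q ^ m)" for m
    using h0 by (simp add: power_int_diff flip: of_nat_power)
  have "h / h ^ (q ^ (t + 1)) = - (h * Fr 1 h)"
  proof -
    have "h ^ (q ^ (t + 1)) = - inverse (Fr 1 h)"
      using Fr_add_t[OF h, of 1] Fr_of_nat[of "t + 1" h] by (simp add: add.commute)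
    then show ?thesis by (simp only: divide_inverse inverse_minus_eq inverse_inverse_eq mult_minus_right)
  qed
  then show ?thesis
    using Fr_of_nat[of 1 x] Fr_of_nat[of "t - 1" x] Fr_of_nat[of "t + 1" x] t_gt
    unfolding psi_def powi last by (simp add: of_nat_diff add.commute)
qed

text \<open>In this range \<open>j\<close> has distance at most \<open>t + 4\<close> from each of
  the four indices. Since \<open>t > 4\<close>, this is below \<open>2 * t\<close>, so congruent
  indices are equal.\<close>

lemma coef_psi:
  assumes h: "h ^ (q ^ t + 1) = - 1" and "- 3 \<le> j" "j \<le> int t + 3"
  shows "coef (psi q t h) j = (if j = 1 then 1 else 0) + (if j = int t - 1 then 1 else 0)
    + (if j = int t + 1 then h * Fr 1 h else 0) + (if j = - 1 then h / Fr (- 1) h else 0)"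
  unfolding psi_eq[OF h, abs_def] coef_add coef_cmult coef_Fr
  by (subst (1 2 3 4) mod_eq_iff) (use assms t_gt in auto)

lemma linearized_psi:
  assumes h: "h ^ (q ^ t + 1) = - 1"
  shows "linearized (psi q t h)"
  unfolding psi_eq[OF h, abs_def]
  using linearized_monomial[of 1] by (intro linearized_add linearized_monomial) (simp_all only: mult_1)

lemma coef_shift: "coef F (j - int t) = coef F (j + int t)" "coef F (- int t + j) = coef F (int t + j)"
  by (rule coef_cong; simp add: mod_eq_dvd_iff)+

lemma Fr_shift: "Fr (j - int t) x = Fr (j + int t) x"
  by (rule Fr_cong) (simp add: mod_eq_dvd_iff)

lemma Fr_2_alternating:
  assumes "x * Fr 2 x = 1"
  shows "Fr (2 * int m) x = (if even m then x else inverse x)"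
proof (induction m)
  case (Suc m)
  have "Fr 2 x = inverse x" using assms by (simp add: inverse_unique)
  then show ?case using Suc Fr_Fr[of 2 "2 * int m" x] by (auto simp: Fr_inverse algebra_simps)
qed simp

lemma two_neq_0: "(2 :: 'a) \<noteq> 0"
proof
  assume "(2 :: 'a) = 0"
  then have "of_nat 2 = (0 :: 'a)" by simp
  then have "p dvd 2" unfolding of_nat_eq_0_iff_char_dvd CHAR_eq .
  then show False using prime_p odd_p primes_dvd_imp_eq two_is_prime_nat by blast
qed

text \<open>Otherwise \<open>Fr 2\<close> inverts \<open>h\<close>. Iterating it up to index
  \<open>t\<close> (for even \<open>t\<close>) or \<open>2 * t\<close> (for odd \<open>t\<close>)
  gives \<open>h * h = 1\<close> or \<open>h * h = - 1\<close>. Then \<open>Fr 1 h\<close> is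
  \<open>h\<close> or \<open>- h\<close>, so \<open>Fr 2\<close> fixes \<open>h\<close>, whence
  \<open>h = 1\<close> or \<open>h = - 1\<close>; both contradict the norm condition in odd
  characteristic.\<close>

lemma mult_Fr_2_neq_1:
  assumes h: "h ^ (q ^ t + 1) = - 1"
  shows "h * Fr 2 h \<noteq> 1"
proof
  assume a: "h * Fr 2 h = 1"
  note alt = Fr_2_alternating[OF a]
  have h0: "h \<noteq> 0" using h by auto
  have one: "(1 :: 'a) \<noteq> - 1" using two_neq_0 by (metis add.right_inverse one_add_one)
  have "h * h = 1 \<or> h * h = - 1"
  proof (cases "even t")
    case True
    then obtain m where "t = 2 * m" by blast
    then have "2 * int m = 0 + int t" by simp
    then have "- inverse h = (if even m then h else inverse h)"
      using alt[of m] unfolding Fr_add_t[OF h] \<open>2 * int m = 0 + int t\<close> by simp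
    then show ?thesis using h0 one by (auto simp: field_simps split: if_splits)
  next
    case False
    have "Fr (2 * int t) h = h" using Fr_cong[of "2 * int t" 0 h] by simp
    then show ?thesis using alt[of t] False h0 by (simp add: field_simps)
  qed
  then have sq: "h ^ 2 = 1 \<or> h ^ 2 = - 1" by (simp add: power2_eq_square)
  then have "Fr 1 h ^ 2 = h ^ 2" by (metis Fr_1 Fr_power Fr_uminus)
  then have "Fr 1 h = h \<or> Fr 1 h = - h" by (simp add: power2_eq_iff)
  then have "Fr 2 h = h" using Fr_Fr[of 1 1 h] by (auto simp: Fr_uminus)
  then have hh: "h * h = 1" using a by simp
  then have "h = 1 \<or> h = - 1" by (simp add: square_eq_1_iff)
  then have "Fr (int t) h = h" by (auto simp: Fr_uminus)
  then have "h = - inverse h" using Fr_add_t[OF h, of 0] by simp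
  then have "h * h = - 1" using h0 by (metis minus_mult_right right_inverse)
  then show False using hh one by simp
qed

text \<open>Comparison of the coefficients of \<open>eq\<close> at index \<open>j\<close>: the five
  terms come from the monomials of the inner polynomial at \<open>0\<close>, \<open>1\<close>,
  \<open>t - 1\<close>, \<open>t + 1\<close> and \<open>- 1\<close>.\<close>

lemma comp_identity:
  assumes F: "linearized F"
    and eq: "\<And>x. F (a * x + b * psi q t h x) = c * x + d * psi q t h x"
    and h: "h ^ (q ^ t + 1) = - 1" and j: "\<bar>j\<bar> < 2 * int t"
  defines "A \<equiv> h * Fr 1 h" and "D \<equiv> h / Fr (- 1) h"
  shows "coef F j * Fr j a + coef F (j - 1) * Fr (j - 1) b
    + coef F (j - (int t - 1)) * Fr (j - (int t - 1)) b
    + coef F (j - (int t + 1)) * Fr (j - (int t + 1)) (b * A)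
    + coef F (j - (- 1)) * Fr (j - (- 1)) (b * D)
    = (if j = 0 then c else 0) + d * coef (psi q t h) j"
proof -
  note add = linearized_additive[OF F]
  have F0: "F 0 = 0" using add[of 0 0] by (metis add.right_neutral add_left_cancel)
  have "(\<lambda>x. F (a * Fr 0 x) + F (b * Fr 1 x) + F (b * Fr (int t - 1) x) + F ((b * A) * Fr (int t + 1) x)
    + F ((b * D) * Fr (- 1) x)) = (\<lambda>x. c * Fr 0 x + d * psi q t h x)"
    (is "?l = ?r")
  proof
    fix x
    have "a * x + b * psi q t h x = a * Fr 0 x + b * Fr 1 x + b * Fr (int t - 1) x
      + (b * A) * Fr (int t + 1) x + (b * D) * Fr (- 1) x"
      unfolding psi_eq[OF h] A_def D_def by (simp add: algebra_simps)
    then show "?l x = ?r x" using eq[of x] by (simp only: add Fr_index_0)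
  qed
  then have "coef ?l j = coef ?r j" by (rule arg_cong)
  then show ?thesis
    using mod_eq_iff[of 0 j] j
    unfolding coef_add coef_cmult coef_comp_monomial[of F, OF F0] coef_Fr by simp
qed

end

section \<open>Field identities for the elimination steps\<close>

text \<open>For the equations at two indices differing by \<open>t\<close>: the coefficients of \<open>F\<close> at distance 3 from
  \<open>0\<close> and \<open>t\<close> are not known, but the system is degenerate in them, so they drop out.\<close>

lemma eliminate_pair:
  fixes P Q X Y u v w :: "'a::field"
  assumes nz: "u \<noteq> 0" "v \<noteq> 0" "w \<noteq> 0" and ne: "u * w \<noteq> 1"
    and eq1: "P + Y + Q / (u * v) + X * (w / v) = 0"
    and eq2: "Q + X + P * (u * v) + Y * (v / w) = 0"
  shows "P * (u * v) = - Q"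
proof -
  have "(P + Y + Q / (u * v) + X * (w / v)) * (u * v) = P * (u * v) + Y * (u * v) + Q + X * (u * w)"
    using nz by (simp add: field_simps)
  then have "P * (u * v) + Y * (u * v) + Q + X * (u * w) = 0" using eq1 by simp
  \<comment> \<open>Subtracting \<open>eq2\<close> from \<open>u * v\<close> times
    \<open>eq1\<close> leaves a multiple of \<open>u * w - 1\<close>, so the part of
    \<open>eq2\<close> in \<open>X\<close> and \<open>Y\<close> vanishes.\<close>
  moreover have "(u * w - 1) * (X + Y * (v / w)) =
    (P * (u * v) + Y * (u * v) + Q + X * (u * w)) - (Q + X + P * (u * v) + Y * (v / w))"
    using nz by (simp add: field_simps)
  ultimately have "(u * w - 1) * (X + Y * (v / w)) = 0" using eq2 by (simp only: diff_self)
  then have "X + Y * (v / w) = 0" using ne by simp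
  moreover have "P * (u * v) + Q = (Q + X + P * (u * v) + Y * (v / w)) - (X + Y * (v / w))" by simp
  ultimately show ?thesis using eq2 by (simp only: diff_self eq_neg_iff_add_eq_0)
qed

text \<open>Digits name Frobenius indices, \<open>hm\<close> is \<open>Fr (- 1) h\<close>, and
  \<open>yt\<close>, \<open>yt1\<close> are the conjugates of \<open>y\<close> at \<open>t\<close>,
  \<open>t + 1\<close>. Multiplying the four relations cancels every conjugate of \<open>y\<close>
  as well as \<open>\<beta>\<close>.\<close>

lemma eliminate_ratios:
  fixes y y1 yt yt1 k k1 k2 h h1 h2 h3 hm \<alpha> \<beta> :: "'a::field"
  assumes nz: "yt \<noteq> 0" "yt1 \<noteq> 0" "\<alpha> \<noteq> 0" "k1 \<noteq> 0" "h \<noteq> 0" "h1 \<noteq> 0" "h2 \<noteq> 0" "h3 \<noteq> 0"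
    and 1: "y * hm = yt * k1\<^sup>2 * h * h1 * h2"
    and 2: "y1 * h = yt1 * k2\<^sup>2 * h1 * h2 * h3"
    and 3: "y * y1 * hm * \<alpha> * k = k1 * h * h1 * h2\<^sup>2 * h3 * \<beta>"
    and 4: "yt * yt1 * \<alpha> * k1 * h * h1 * h2\<^sup>2 = \<beta> * k"
  shows "k\<^sup>2 * k2\<^sup>2 = h\<^sup>2 * h2\<^sup>2"
proof -
  let ?c = "yt * yt1 * \<alpha> * k1\<^sup>2 * h * h1\<^sup>2 * h2\<^sup>2 * h3"
  have "?c * (k\<^sup>2 * k2\<^sup>2) = (yt * k1\<^sup>2 * h * h1 * h2) * (yt1 * k2\<^sup>2 * h1 * h2 * h3) * \<alpha> * k\<^sup>2"
    by (simp add: power2_eq_square mult_ac)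
  also have "\<dots> = (y * y1 * hm * \<alpha> * k) * (h * k)"
    unfolding 1[symmetric] 2[symmetric] by (simp add: power2_eq_square mult_ac)
  also have "\<dots> = (k1 * h * h1 * h2\<^sup>2 * h3) * h * (\<beta> * k)"
    unfolding 3 by (simp add: mult_ac)
  also have "\<dots> = ?c * (h\<^sup>2 * h2\<^sup>2)"
    unfolding 4[symmetric] by (simp add: power2_eq_square mult_ac)
  finally show ?thesis using nz by simp
qed

text \<open>Applying \<open>Fr (int t)\<close> turns each conjugate of \<open>h\<close> and
  \<open>k\<close> into its negative inverse; multiplying by \<open>?c\<close> removes the inverses
  from the resulting equation.\<close>

lemma clear_inverses:
  fixes Y k k1 h h1 h2 h3 hm :: "'a::field"
  assumes nz: "k \<noteq> 0" "k1 \<noteq> 0" "h \<noteq> 0" "h1 \<noteq> 0" "h2 \<noteq> 0" "h3 \<noteq> 0" "hm \<noteq> 0"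
    and eq: "Y * (- inverse hm) * (inverse (h1 * h3) - 1) * (- inverse k) =
      (- inverse k1) * (- inverse h) * (- inverse h1) * (inverse h2)\<^sup>2 * (- inverse h3) * (inverse (h1 * hm) - 1)"
      (is "?l = ?r")
  shows "Y * (h1 * h3 - 1) * k1 * h * h1 * h2\<^sup>2 = (h1 * hm - 1) * k"
proof -
  let ?c = "- (hm * h1 * h3 * k * k1 * h * h1 * h2\<^sup>2)"
  have a: "(inverse (h1 * h3) - 1) * (h1 * h3) = 1 - h1 * h3"
    and b: "(inverse (h1 * hm) - 1) * (h1 * hm) = 1 - h1 * hm" using nz by (simp_all add: algebra_simps)
  have "Y * (h1 * h3 - 1) * k1 * h * h1 * h2\<^sup>2 = - (Y * (1 - h1 * h3) * k1 * h * h1 * h2\<^sup>2)"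
    by (simp add: algebra_simps)
  also have "\<dots> = - (Y * ((inverse (h1 * h3) - 1) * (h1 * h3)) * k1 * h * h1 * h2\<^sup>2
      * (inverse hm * hm) * (inverse k * k))" unfolding a using nz by simp
  also have "\<dots> = ?l * ?c" by (simp only: mult_ac mult_minus_left mult_minus_right minus_minus)
  also have "\<dots> = - (k * ((inverse (h1 * hm) - 1) * (h1 * hm)) * (inverse k1 * k1) * (inverse h * h)
      * (inverse h1 * h1) * (inverse h2 * h2)\<^sup>2 * (inverse h3 * h3))"
    unfolding eq by (simp only: mult_ac power_mult_distrib mult_minus_left mult_minus_right minus_minus)
  also have "\<dots> = (h1 * hm - 1) * k" unfolding b using nz by (simp add: algebra_simps)
  finally show ?thesis .
qed

section \<open>Conditions on \<open>k / h\<close> forced by linear equivalence\<close>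

context linset_field
begin

lemma ratio_power_eq_1:
  assumes h: "h ^ (q ^ t + 1) = - 1"
    and key: "k ^ 2 * Fr 2 k ^ 2 = h ^ 2 * Fr 2 h ^ 2"
  shows "(k / h) ^ (2 * (q ^ 2 + 1)) = 1"
proof -
  have h0: "h \<noteq> 0" using h by auto
  have "Fr 2 x = x ^ q ^ 2" for x using Fr_of_nat[of 2 x] by simp
  then have "(k / h) ^ (q ^ 2 + 1) = (k * Fr 2 k) / (h * Fr 2 h)" by (simp add: power_divide)
  then have "((k / h) ^ (q ^ 2 + 1)) ^ 2 = (k * Fr 2 k) ^ 2 / (h * Fr 2 h) ^ 2" by (simp only: power_divide)
  moreover have "((k / h) ^ (q ^ 2 + 1)) ^ 2 = (k / h) ^ (2 * (q ^ 2 + 1))"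
    by (simp only: mult.commute flip: power_mult)
  ultimately have "(k / h) ^ (2 * (q ^ 2 + 1)) = (k ^ 2 * Fr 2 k ^ 2) / (h ^ 2 * Fr 2 h ^ 2)"
    by (simp only: power_mult_distrib)
  then show ?thesis using key h0 by simp
qed

text \<open>Both \<open>Fr 2\<close> and \<open>Fr (int t)\<close> invert
  \<open>(k / h) ^ 2\<close>. If \<open>4\<close> divides \<open>t\<close>, then
  \<open>Fr (int t)\<close> is an even iterate of \<open>Fr 2\<close> and also fixes it; if
  \<open>t\<close> is odd, the identity \<open>Fr (2 * int t)\<close> is an odd iterate and inverts
  it.\<close>

lemma fourth_power_eq_1:
  assumes h: "h ^ (q ^ t + 1) = - 1" and k: "k ^ (q ^ t + 1) = - 1"
    and key: "k ^ 2 * Fr 2 k ^ 2 = h ^ 2 * Fr 2 h ^ 2" and t: "t mod 4 \<noteq> 2"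
  shows "(k / h) ^ 4 = 1"
proof -
  let ?m = "(k / h) ^ 2"
  have h0: "h \<noteq> 0" "k \<noteq> 0" using h k by auto
  have "?m * Fr 2 ?m = 1" using key h0 by (simp add: Fr_power Fr_divide power_divide)
  note alt = Fr_2_alternating[OF this]
  have Ft: "Fr (int t) ?m = inverse ?m"
    using Fr_add_t[OF h, of 0] Fr_add_t[OF k, of 0] h0
    by (simp add: Fr_power Fr_divide Fr_inverse Fr_mult power_mult_distrib power_inverse divide_inverse mult.commute)
  have "?m = inverse ?m"
  proof (cases "even t")
    case True
    then obtain m where m: "t = 2 * m" by blast
    then have "even m" using t by presburger
    moreover have "2 * int m = int t" using m by simp
    ultimately show ?thesis using alt[of m] Ft by simp
  next
    case False
    have "Fr (2 * int t) ?m = ?m" using Fr_cong[of "2 * int t" 0 ?m] by simp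
    then show ?thesis using alt[of t] False by simp
  qed
  then have "?m * ?m = 1" using h0 by (metis divide_eq_0_iff power_eq_0_iff right_inverse)
  then show ?thesis by (simp flip: power_add)
qed

text \<open>Here \<open>F\<close> is the second coordinate of the linear image as a function of the
  first, and \<open>nonzero\<close> says that the second column of the matrix does not vanish. Power
  sums tie the coefficients of \<open>F\<close> to \<open>k\<close>; \<open>comp_identity\<close>
  ties them to \<open>h\<close> and the matrix.\<close>

lemma linear_equivalence_condition:
  assumes h: "h ^ (q ^ t + 1) = - 1" and k: "k ^ (q ^ t + 1) = - 1"
    and F: "linearized F"
    and same: "{F x / x | x. x \<noteq> 0} = {psi q t k x / x | x. x \<noteq> 0}"
    and eq: "\<And>x. F (a * x + b * psi q t h x) = c * x + d * psi q t h x"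
    and nonzero: "b \<noteq> 0 \<or> d \<noteq> 0"
  shows "k ^ 2 * Fr 2 k ^ 2 = h ^ 2 * Fr 2 h ^ 2"
proof -
  have h0: "h \<noteq> 0" and k0: "k \<noteq> 0" using h k by auto
  note G = linearized_psi[OF k]
  note g = coef_psi[OF k]
  note ht = Fr_add_t[OF h] and kt = Fr_add_t[OF k]
  have ht': "Fr (int t + i) h = - inverse (Fr i h)" for i using ht[of i] by (simp add: add.commute)
  have ht'': "Fr (int t) h = - inverse h" using ht[of 0] by simp
  have kt': "Fr (int t) k = - inverse k" using kt[of 0] by simp
  have kt'': "Fr (int t - 1) k = - inverse (Fr (- 1) k)" using kt[of "- 1"] by simp
  have per: "Fr (int t + int t) x = x" "Fr (2 * int t) x = x" "Fr (int t * 2) x = x" for x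
    using Fr_cong[of "int t + int t" 0 x] Fr_cong[of "2 * int t" 0 x] by (simp_all add: mult.commute)
  have hts: "Fr (int t + 1) h = - inverse (Fr 1 h)" "Fr (int t + 2) h = - inverse (Fr 2 h)"
    "Fr (int t + 3) h = - inverse (Fr 3 h)" "Fr (int t - 1) h = - inverse (Fr (- 1) h)"
    "Fr (int t - 2) h = - inverse (Fr (- 2) h)" "Fr (int t - 3) h = - inverse (Fr (- 3) h)"
    using ht'[of 1] ht'[of 2] ht'[of 3] ht'[of "- 1"] ht'[of "- 2"] ht'[of "- 3"] by simp_all
  have Frs: "Fr (1 - int t) x = Fr (int t + 1) x" "Fr (2 - int t) x = Fr (int t + 2) x"
    "Fr (3 - int t) x = Fr (int t + 3) x" "Fr (- 1 - int t) x = Fr (int t - 1) x"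
    "Fr (- 2 - int t) x = Fr (int t - 2) x" "Fr (- 3 - int t) x = Fr (int t - 3) x" for x
    using Fr_shift[of 1 x] Fr_shift[of 2 x] Fr_shift[of 3 x]
      Fr_shift[of "- 1" x] Fr_shift[of "- 2" x] Fr_shift[of "- 3" x]
    by (simp_all add: add.commute)
  let ?f = "coef F"
  have gm2: "coef (psi q t k) (- 2) = 0" "coef (psi q t k) 2 = 0" "coef (psi q t k) 0 = 0"
    "coef (psi q t k) (int t) = 0" "coef (psi q t k) (int t + 2) = 0" "coef (psi q t k) (int t - 2) = 0"
    using t_gt by (simp_all add: g)
  have sh: "coef G (1 - int t) = coef G (int t + 1)" "coef G (2 - int t) = coef G (int t + 2)" "coef G (- int t - 2) = coef G (int t - 2)" "coef G (3 - int t) = coef G (int t + 3)" "coef G (- int t) = coef G (int t)"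
    "coef G (- 1 - int t) = coef G (int t - 1)" "coef G (- 2 - int t) = coef G (int t - 2)"
    "coef G (- 3 - int t) = coef G (int t - 3)" for G
    using coef_shift(1)[of G 1] coef_shift(1)[of G 2] coef_shift(1)[of G 3] coef_shift(1)[of G 0]
      coef_shift(1)[of G "- 1"] coef_shift(1)[of G "- 2"] coef_shift(1)[of G "- 3"]
      coef_shift(2)[of G "- 2"]
    by (simp_all add: add.commute)
  have f0: "?f 0 = 0" using same_coef_0[OF F G same] gm2 by simp
  note pair = same_coef_pair[OF F G same gm2(3)] and triple = same_coef_triple[OF F G same gm2(3)]
  have pair1: "?f 1 * Fr 1 (?f (- 1)) = Fr 1 k / k"
    using pair[of 1] t_gt by (simp add: g Fr_divide Fr_Fr)
  have pairt1: "?f (int t - 1) * Fr (int t - 1) (?f (int t + 1)) = 1 / (k * Fr (- 1) k)"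
    using pair[of "int t - 1"] t_gt k0
    by (simp add: g sh Fr_mult Fr_Fr kt' kt'' divide_inverse)
  have nz: "?f 1 \<noteq> 0" "?f (- 1) \<noteq> 0" "?f (int t - 1) \<noteq> 0" "?f (int t + 1) \<noteq> 0"
    using pair1 pairt1 k0 by (auto simp: field_simps)
  \<comment> \<open>Index \<open>- t\<close> equals \<open>t\<close>, so the pair relation is the
    coefficient times its own conjugate.\<close>
  have ft: "?f (int t) = 0"
    using pair[of "int t"] t_gt gm2 by (simp add: sh)
  \<comment> \<open>The pair relation makes one of the two coefficients vanish; in the triple
    relation each is multiplied by nonzero coefficients, so the other vanishes too. The indices
    \<open>t + 2\<close> and \<open>t - 2\<close> work alike.\<close>
  have f2: "?f 2 = 0 \<and> ?f (- 2) = 0"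
    using pair[of 2] triple[of 2] t_gt gm2 nz by auto
  have ft2: "?f (int t + 2) = 0 \<and> ?f (int t - 2) = 0"
    using pair[of "int t + 2"] triple[of "int t + 2"] t_gt gm2 nz by (auto simp: sh add.commute[of 1 "int t"])
  note zeros = f0 ft f2 ft2
  note tc = add.commute[of 1 "int t"] add.commute[of 2 "int t"] add.commute[of 3 "int t"]
  note id = comp_identity[OF F eq h]
  note fs = coef_psi[OF h]
  \<comment> \<open>At \<open>1\<close>, \<open>- 1\<close>, \<open>t + 1\<close> and
    \<open>t - 1\<close> every shifted index is one of those in \<open>zeros\<close>, so only the
    term with \<open>a\<close> remains.\<close>
  have e1: "?f 1 * Fr 1 a = d"
    using id[of 1] zeros t_gt by (simp add: tc sh fs)
  have em1: "?f (- 1) * Fr (- 1) a = d * (h / Fr (- 1) h)"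
    using id[of "- 1"] zeros t_gt by (simp add: tc sh fs)
  have et1: "?f (int t + 1) * Fr (int t + 1) a = d * (h * Fr 1 h)"
    using id[of "int t + 1"] zeros t_gt by (simp add: tc sh fs)
  have etm1: "?f (int t - 1) * Fr (int t - 1) a = d"
    using id[of "int t - 1"] zeros t_gt by (simp add: tc sh fs)
  show ?thesis
  proof (cases "a = 0")
    case False
    then have d0: "d \<noteq> 0" using e1 nz by auto
    \<comment> \<open>All four coefficients are now explicit, and the pair relations become
      equations in \<open>\<delta>\<close> and \<open>\<kappa>\<close> alone.\<close>
    define \<delta> where "\<delta> = d / a"
    define \<kappa> where "\<kappa> = k / h"
    have \<delta>0: "\<delta> \<noteq> 0" and \<kappa>0: "\<kappa> \<noteq> 0" using d0 False h0 k0 by (auto simp: \<delta>_def \<kappa>_def)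
    have \<kappa>t: "Fr (int t) \<kappa> = inverse \<kappa>"
      using kt' ht'' h0 k0 by (simp add: \<kappa>_def Fr_mult Fr_inverse divide_inverse)
    have f1: "?f 1 = d / Fr 1 a" "?f (- 1) = d * (h / Fr (- 1) h) / Fr (- 1) a"
      "?f (int t + 1) = d * (h * Fr 1 h) / Fr (int t + 1) a" "?f (int t - 1) = d / Fr (int t - 1) a"
      using e1 em1 et1 etm1 by (simp_all only: eq_divide_eq Fr_eq_0_iff False if_True not_False_eq_True)
    have r1: "\<delta> * Fr 1 \<delta> = Fr 1 \<kappa> / \<kappa>"
      using pair1 False h0 k0 d0 unfolding f1
      by (simp add: \<delta>_def \<kappa>_def Fr_mult Fr_divide Fr_Fr field_simps)
    have "Fr (int t - 1) (?f (int t + 1)) = Fr (int t - 1) d / (h * Fr (- 1) h) / a"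
      unfolding f1 using h0
      by (simp add: Fr_mult Fr_inverse Fr_Fr per ht'' hts divide_inverse mult_ac)
    then have "d / Fr (int t - 1) a * (Fr (int t - 1) d / (h * Fr (- 1) h) / a) = 1 / (k * Fr (- 1) k)"
      using pairt1 unfolding f1(4) by simp
    then have "\<delta> * Fr (int t - 1) \<delta> / (h * Fr (- 1) h) = 1 / (k * Fr (- 1) k)"
      by (simp add: \<delta>_def Fr_divide mult_ac)
    then have "\<delta> * Fr (int t - 1) \<delta> = inverse (\<kappa> * Fr (- 1) \<kappa>)"
      using h0 k0 by (simp add: \<kappa>_def Fr_divide field_simps)
    from arg_cong[OF this, of "Fr 1"] have r2: "Fr 1 \<delta> * Fr (int t) \<delta> = inverse (Fr 1 \<kappa> * \<kappa>)"
      by (simp add: Fr_mult Fr_inverse Fr_Fr)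
    have \<delta>1: "Fr 1 \<delta> \<noteq> 0" and \<kappa>1: "Fr 1 \<kappa> \<noteq> 0" "Fr 2 \<kappa> \<noteq> 0" using \<delta>0 \<kappa>0 by simp_all
    have "\<delta> = Fr 1 \<kappa> / (\<kappa> * Fr 1 \<delta>)" using r1 \<delta>1 \<kappa>0 by (simp add: field_simps)
    moreover have "Fr (int t) \<delta> = inverse (Fr 1 \<delta> * (Fr 1 \<kappa> * \<kappa>))"
      using r2 \<delta>1 by (metis inverse_mult_distrib mult.left_commute mult.right_neutral right_inverse)
    ultimately have s0: "\<delta> = Fr (int t) \<delta> * Fr 1 \<kappa> ^ 2"
      using \<kappa>1 by (simp add: field_simps power2_eq_square)
    from arg_cong[OF this, of "Fr 1"] have s1: "Fr 1 \<delta> = Fr (int t + 1) \<delta> * Fr 2 \<kappa> ^ 2"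
      by (simp add: Fr_mult Fr_power Fr_Fr add.commute)
    have \<kappa>t1: "Fr (1 + int t) \<kappa> = inverse (Fr 1 \<kappa>)"
      using arg_cong[OF \<kappa>t, of "Fr 1"] by (simp add: Fr_Fr Fr_inverse)
    from arg_cong[OF r1, of "Fr (int t)"] have s2: "Fr (int t) \<delta> * Fr (int t + 1) \<delta> = \<kappa> / Fr 1 \<kappa>"
      by (simp add: \<kappa>t1 Fr_mult Fr_inverse Fr_Fr \<kappa>t divide_inverse add.commute mult.commute)
    \<comment> \<open>The product of \<open>s0\<close> and \<open>s1\<close> compares
      \<open>r1\<close> with its own conjugate \<open>s2\<close>, which eliminates
      \<open>\<delta>\<close>.\<close>
    have "Fr 1 \<kappa> / \<kappa> = (Fr (int t) \<delta> * Fr (int t + 1) \<delta>) * (Fr 1 \<kappa> ^ 2 * Fr 2 \<kappa> ^ 2)"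
      using r1 s0 s1 by (metis mult.assoc mult.left_commute)
    then have "\<kappa> ^ 2 * Fr 2 \<kappa> ^ 2 = 1"
      unfolding s2 using \<kappa>0 \<kappa>1 by (simp add: field_simps power2_eq_square)
    then show ?thesis using h0 k0 by (simp add: \<kappa>_def Fr_divide field_simps)
  next
    case True
    then have d0: "d = 0" and b0: "b \<noteq> 0" using e1 nonzero by auto
    \<comment> \<open>The four nonzero coefficients of \<open>F\<close>, each with the conjugate of
      \<open>b\<close> that accompanies it in \<open>comp_identity\<close>.\<close>
    define P where "P = ?f 1 * Fr 1 b"
    define Q where "Q = ?f (int t + 1) * Fr (int t + 1) b"
    define R where "R = ?f (- 1) * Fr (- 1) b"
    define T where "T = ?f (int t - 1) * Fr (int t - 1) b"
    have Q0: "Q \<noteq> 0" using nz b0 by (simp add: Q_def)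
    have w: "Fr i h * Fr (i + 2) h \<noteq> 1" for i
    proof
      assume "Fr i h * Fr (i + 2) h = 1"
      then have "Fr i (h * Fr 2 h) = Fr i 1" by (simp add: Fr_mult Fr_Fr)
      then show False using mult_Fr_2_neq_1[OF h] bij_Fr[THEN bij_is_inj, THEN injD] by blast
    qed
    note wi = w[of 1] w[of "- 1"] w[of "- 3"]
    \<comment> \<open>Indices \<open>2\<close> and \<open>t + 2\<close> involve the unknown
      coefficients at \<open>3\<close> and \<open>t + 3\<close>, which take the places of
      \<open>X\<close> and \<open>Y\<close> in \<open>eliminate_pair\<close>.\<close>
    have e2: "P + ?f (int t + 3) * Fr (int t + 3) b + Q / (Fr 1 h * Fr 2 h)
        + ?f 3 * Fr 3 b * (Fr 3 h / Fr 2 h) = 0"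
      using id[of 2] zeros t_gt True d0
      by (simp add: tc sh P_def Q_def Frs hts Fr_mult Fr_inverse Fr_Fr divide_inverse mult_ac)
    have et2: "Q + ?f 3 * Fr 3 b + P * (Fr 1 h * Fr 2 h)
        + ?f (int t + 3) * Fr (int t + 3) b * (Fr 2 h / Fr 3 h) = 0"
      using id[of "int t + 2"] zeros t_gt True d0
      by (simp add: tc sh P_def Q_def Frs hts Fr_mult Fr_inverse Fr_Fr divide_inverse mult_ac)
    have PQ: "P * (Fr 1 h * Fr 2 h) = - Q"
      using eliminate_pair[OF _ _ _ _ e2 et2] wi h0 by simp
    have em2: "?f (- 3) * Fr (- 3) b + T + ?f (int t - 3) * Fr (int t - 3) b / (Fr (- 3) h * Fr (- 2) h)
        + R * (Fr (- 1) h / Fr (- 2) h) = 0"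
      using id[of "- 2"] zeros t_gt True d0
      by (simp add: tc sh T_def R_def Frs hts Fr_mult Fr_inverse Fr_Fr divide_inverse mult_ac)
    have etm2: "?f (int t - 3) * Fr (int t - 3) b + R + ?f (- 3) * Fr (- 3) b * (Fr (- 3) h * Fr (- 2) h)
        + T * (Fr (- 2) h / Fr (- 1) h) = 0"
      using id[of "int t - 2"] zeros t_gt True d0
      by (simp add: tc sh T_def R_def Frs hts Fr_mult Fr_inverse Fr_Fr divide_inverse mult_ac)
    \<comment> \<open>Here the unknown terms take the places of \<open>P\<close> and
      \<open>Q\<close> in \<open>eliminate_pair\<close>, so they cancel in
      \<open>etm2\<close>.\<close>
    have "?f (- 3) * Fr (- 3) b * (Fr (- 3) h * Fr (- 2) h) = - (?f (int t - 3) * Fr (int t - 3) b)"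
      using eliminate_pair[OF _ _ _ _ em2 etm2] wi h0 by simp
    then have "R + T * (Fr (- 2) h / Fr (- 1) h) = 0" using etm2 by simp
    then have TR: "T * Fr (- 2) h = - (R * Fr (- 1) h)" using h0
      by (simp add: field_simps eq_neg_iff_add_eq_0)
    have "T + P + R * (Fr (- 1) h * h) + Q * (h / Fr 1 h) = 0"
      using id[of "int t"] zeros t_gt True d0
      by (simp add: tc sh fs P_def Q_def T_def R_def Frs hts ht'' Fr_mult Fr_inverse Fr_Fr divide_inverse mult_ac)
    then have et: "P + T + Q * (h / Fr 1 h) + R * (Fr (- 1) h * h) = 0" by (simp add: add_ac)
    have "P * Fr 1 R = (?f 1 * Fr 1 (?f (- 1))) * (Fr 1 b * b)"
      by (simp add: P_def R_def Fr_mult Fr_Fr mult_ac)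
    then have PR: "P * Fr 1 R * k = Fr 1 b * b * Fr 1 k"
      unfolding pair1 using k0 by (simp add: field_simps)
    have "T * Fr (int t - 1) Q = (?f (int t - 1) * Fr (int t - 1) (?f (int t + 1))) * (Fr (int t - 1) b * b)"
      by (simp add: T_def Q_def Fr_mult Fr_Fr per mult_ac)
    then have "T * Fr (int t - 1) Q * (k * Fr (- 1) k) = Fr (int t - 1) b * b"
      unfolding pairt1 using k0 by (simp add: field_simps)
    from arg_cong[OF this, of "Fr 1"]
    have TQ: "Fr 1 T * Fr (int t) Q * (Fr 1 k * k) = Fr (int t) b * Fr 1 b"
      by (simp add: Fr_mult Fr_Fr)
    have R0: "Fr 1 R \<noteq> 0" using nz b0 by (simp add: R_def)
    have PQ1: "Fr 1 P * (Fr 2 h * Fr 3 h) = - Fr 1 Q"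
      using arg_cong[OF PQ, of "Fr 1"] by (simp add: Fr_mult Fr_Fr Fr_uminus)
    have TR1: "Fr 1 T * Fr (- 1) h = - (Fr 1 R * h)"
      using arg_cong[OF TR, of "Fr 1"] by (simp add: Fr_mult Fr_Fr Fr_uminus)
    have et1: "Fr 1 P + Fr 1 T + Fr 1 Q * (Fr 1 h / Fr 2 h) + Fr 1 R * (h * Fr 1 h) = 0"
      using arg_cong[OF et, of "Fr 1"] by (simp add: Fr_add Fr_mult Fr_Fr Fr_divide)
    define y where "y = Q / b"
    have y0: "y \<noteq> 0" using Q0 b0 by (simp add: y_def)
    \<comment> \<open>Combining \<open>PR\<close> with \<open>TQ\<close>, and rewriting by
      \<open>PQ\<close> and \<open>TR1\<close>, lets \<open>Fr 1 R * k\<close> cancel. What remains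
      relates \<open>Q / b\<close> to its conjugate at \<open>t\<close>.\<close>
    have "(P * (Fr 1 h * Fr 2 h)) * Fr 1 R * k * (Fr (- 1) h * Fr (int t) b) =
      (P * Fr 1 R * k) * (Fr 1 h * Fr 2 h * Fr (- 1) h * Fr (int t) b)" by (simp add: mult_ac)
    also have "\<dots> = (Fr (int t) b * Fr 1 b) * (b * Fr 1 k * Fr 1 h * Fr 2 h * Fr (- 1) h)"
      unfolding PR by (simp add: mult_ac)
    also have "\<dots> = (Fr 1 T * Fr (- 1) h) * Fr (int t) Q * (Fr 1 k * k) * (b * Fr 1 k * Fr 1 h * Fr 2 h)"
      unfolding TQ[symmetric] by (simp add: mult_ac)
    finally have "(Fr 1 R * k) * (Q * Fr (- 1) h * Fr (int t) b) =
      (Fr 1 R * k) * (Fr (int t) Q * b * (Fr 1 k)\<^sup>2 * h * Fr 1 h * Fr 2 h)"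
      unfolding PQ TR1 by (simp add: power2_eq_square mult_ac)
    then have "Q * Fr (- 1) h * Fr (int t) b = Fr (int t) Q * b * (Fr 1 k)\<^sup>2 * h * Fr 1 h * Fr 2 h"
      using R0 k0 by simp
    then have y1: "y * Fr (- 1) h = Fr (int t) y * (Fr 1 k)\<^sup>2 * h * Fr 1 h * Fr 2 h"
      using b0 by (simp add: y_def Fr_divide field_simps)
    from arg_cong[OF this, of "Fr 1"]
    have y2: "Fr 1 y * h = Fr (int t + 1) y * (Fr 2 k)\<^sup>2 * Fr 1 h * Fr 2 h * Fr 3 h"
      by (simp add: Fr_mult Fr_Fr Fr_power add.commute)
    \<comment> \<open>Clearing denominators in \<open>et1\<close> expresses \<open>Fr 1 Q\<close>
      through \<open>Fr 1 R\<close>; multiplying by \<open>Q\<close> then allows \<open>PQ\<close>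
      and \<open>PR\<close> to bring in \<open>b\<close>.\<close>
    have "(Fr 1 P + Fr 1 T + Fr 1 Q * (Fr 1 h / Fr 2 h) + Fr 1 R * (h * Fr 1 h)) * (Fr 2 h * Fr 3 h * Fr (- 1) h)
      = (Fr 1 P * (Fr 2 h * Fr 3 h)) * Fr (- 1) h + (Fr 1 T * Fr (- 1) h) * (Fr 2 h * Fr 3 h)
        + Fr 1 Q * Fr 1 h * Fr 3 h * Fr (- 1) h + Fr 1 R * h * Fr 1 h * Fr 2 h * Fr 3 h * Fr (- 1) h"
      unfolding distrib_right using h0 by (simp add: mult_ac)
    then have QR: "Fr 1 Q * Fr (- 1) h * (Fr 1 h * Fr 3 h - 1) = - (Fr 1 R * h * Fr 2 h * Fr 3 h * (Fr 1 h * Fr (- 1) h - 1))"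
      unfolding et1 PQ1 TR1 by (simp add: algebra_simps eq_neg_iff_add_eq_0)
    have "Q * Fr 1 Q * Fr (- 1) h * (Fr 1 h * Fr 3 h - 1) * k = Q * k * (Fr 1 Q * Fr (- 1) h * (Fr 1 h * Fr 3 h - 1))"
      by (simp add: mult_ac)
    also have "\<dots> = (- Q) * Fr 1 R * k * (h * Fr 2 h * Fr 3 h * (Fr 1 h * Fr (- 1) h - 1))"
      unfolding QR by (simp add: mult_ac)
    also have "\<dots> = (P * Fr 1 R * k) * (Fr 1 h * Fr 2 h * (h * Fr 2 h * Fr 3 h * (Fr 1 h * Fr (- 1) h - 1)))"
      unfolding PQ[symmetric] by (simp add: mult_ac)
    also have "\<dots> = (b * Fr 1 b) * (Fr 1 k * h * Fr 1 h * (Fr 2 h)\<^sup>2 * Fr 3 h * (Fr 1 h * Fr (- 1) h - 1))"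
      unfolding PR by (simp add: power2_eq_square mult_ac)
    finally have QQ: "Q * Fr 1 Q * Fr (- 1) h * (Fr 1 h * Fr 3 h - 1) * k =
      (b * Fr 1 b) * (Fr 1 k * h * Fr 1 h * (Fr 2 h)\<^sup>2 * Fr 3 h * (Fr 1 h * Fr (- 1) h - 1))" .
    have "y * Fr 1 y * Fr (- 1) h * (Fr 1 h * Fr 3 h - 1) * k =
      (Q * Fr 1 Q * Fr (- 1) h * (Fr 1 h * Fr 3 h - 1) * k) / (b * Fr 1 b)"
      by (simp add: y_def Fr_divide)
    then have y3: "y * Fr 1 y * Fr (- 1) h * (Fr 1 h * Fr 3 h - 1) * k =
      Fr 1 k * h * Fr 1 h * (Fr 2 h)\<^sup>2 * Fr 3 h * (Fr 1 h * Fr (- 1) h - 1)"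
      unfolding QQ using b0 by simp
    have kt1: "Fr (int t + 1) k = - inverse (Fr 1 k)" using kt[of 1] by (simp add: add.commute)
    have "Fr (int t) y * Fr (int t + 1) y * (- inverse (Fr (- 1) h)) * (inverse (Fr 1 h * Fr 3 h) - 1) * (- inverse k)
      = (- inverse (Fr 1 k)) * (- inverse h) * (- inverse (Fr 1 h)) * (inverse (Fr 2 h))\<^sup>2 * (- inverse (Fr 3 h))
        * (inverse (Fr 1 h * Fr (- 1) h) - 1)"
      using arg_cong[OF y3, of "Fr (int t)"]
      by (simp add: Fr_mult Fr_Fr Fr_power Fr_diff ht' ht'' ht'[of "- 1", simplified] kt' kt1)
    then have y4: "Fr (int t) y * Fr (int t + 1) y * (Fr 1 h * Fr 3 h - 1) * Fr 1 k * h * Fr 1 h * (Fr 2 h)\<^sup>2 =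
      (Fr 1 h * Fr (- 1) h - 1) * k"
      by (rule clear_inverses[rotated 7]) (use h0 k0 in simp_all)
    have "Fr 1 h * Fr 3 h - 1 \<noteq> 0" using wi by simp
    from eliminate_ratios[OF _ _ this _ _ _ _ _ y1 y2 y3 y4]
    show ?thesis using y0 h0 k0 by simp
  qed
qed

end

section \<open>From semilinear to linear equivalence\<close>

lemma field_automorphism_power_int:
  assumes "field_automorphism \<sigma>"
  shows "\<sigma> (x powi z) = \<sigma> x powi z"
proof -
  have one: "\<sigma> 1 = 1" and add: "\<And>a b. \<sigma> (a + b) = \<sigma> a + \<sigma> b"
    and mult: "\<And>a b. \<sigma> (a * b) = \<sigma> a * \<sigma> b"
    using assms by (auto simp: field_automorphism_def)
  have zero: "\<sigma> 0 = 0" using add[of 0 0] by (metis add.right_neutral add_left_cancel)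
  have pow: "\<sigma> (y ^ m) = \<sigma> y ^ m" for y m by (induction m) (simp_all add: one mult)
  have inv: "\<sigma> (inverse y) = inverse (\<sigma> y)" for y
  proof (cases "y = 0")
    case False
    then have "\<sigma> y * \<sigma> (inverse y) = 1" by (simp add: one flip: mult)
    then show ?thesis by (simp add: inverse_unique)
  qed (simp add: zero)
  show ?thesis by (simp add: power_int_def pow inv)
qed

lemma field_automorphism_psi:
  assumes "field_automorphism \<sigma>"
  shows "\<sigma> (psi q t h x) = psi q t (\<sigma> h) (\<sigma> x)"
proof -
  have add: "\<And>a b. \<sigma> (a + b) = \<sigma> a + \<sigma> b" and mult: "\<And>a b. \<sigma> (a * b) = \<sigma> a * \<sigma> b"
    using assms by (auto simp: field_automorphism_def)
  have diff: "\<sigma> (a - b) = \<sigma> a - \<sigma> b" for a b using add[of "a - b" b] by simp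
  have pow: "\<sigma> (y ^ m) = \<sigma> y ^ m" for y m
    using field_automorphism_power_int[OF assms, of y "int m"] by simp
  show ?thesis by (simp only: psi_def add diff mult pow field_automorphism_power_int[OF assms])
qed

lemma semilinear_image_proj_point:
  assumes "field_automorphism \<sigma>" and "\<And>c v. f (c *s v) = \<sigma> c *s f v"
  shows "f ` proj_point v = proj_point (f v)"
proof -
  have "range \<sigma> = UNIV" using assms(1) by (simp add: field_automorphism_def bij_is_surj)
  then have "range (\<lambda>c. \<sigma> c *s f v) = range (\<lambda>c. c *s f v)"
    using image_image[of "\<lambda>c. c *s f v" \<sigma> UNIV] by simp
  then show ?thesis by (simp add: proj_point_def vec.span_singleton image_image assms(2))
qed

text \<open>Points with nonzero first coordinate are determined by their slope, so point sets can be
  compared through ratios.\<close>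

lemma proj_point_eqD:
  fixes u v y z :: "'a::field"
  assumes "proj_point (vector [u, v]) = proj_point (vector [y, z])" "y \<noteq> 0"
  shows "u \<noteq> 0" "v / u = z / y"
proof -
  have "vector [y, z] \<in> proj_point (vector [u, v])"
    unfolding assms(1) by (simp add: proj_point_def vec.span_base)
  then obtain s where s: "vector [y, z] = s *s (vector [u, v] :: 'a ^ 2)"
    by (auto simp: proj_point_def vec.span_singleton)
  then have "y = s * u" "z = s * v"
    by (metis vector_2(1) vector_smult_component, metis vector_2(2) vector_smult_component)
  then show "u \<noteq> 0" "v / u = z / y" using assms(2) by auto
qed

context linset_field
begin

text \<open>The semilinear map is \<open>\<sigma>\<close> on coordinates followed by the matrix with
  columns \<open>e1\<close>, \<open>e2\<close>. Replacing \<open>h\<close> by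
  \<open>\<sigma> h\<close> absorbs the automorphism, leaving a linear equivalence.\<close>

lemma linset_equivalent_imp:
  assumes h: "(h :: 'a) ^ (q ^ t + 1) = - 1" and k: "k ^ (q ^ t + 1) = - 1"
    and rel: "(linset q t h, linset q t k) \<in> PGammaL2_rel"
  obtains \<sigma> where "field_automorphism \<sigma>" "\<sigma> h ^ (q ^ t + 1) = - 1"
    "k ^ 2 * Fr 2 k ^ 2 = \<sigma> h ^ 2 * Fr 2 (\<sigma> h) ^ 2"
proof -
  obtain f where f: "f \<in> GammaL2" and fL: "linset q t k = (\<lambda>P. f ` P) ` linset q t h"
    using rel by (auto simp: PGammaL2_rel_iff)
  obtain \<sigma> where \<sigma>: "field_automorphism \<sigma>" and sc: "\<And>c v. f (c *s v) = \<sigma> c *s f v"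
    using f by (auto simp: GammaL2_def)
  have fadd: "\<And>u v. f (u + v) = f u + f v" and "bij f" using f by (auto simp: GammaL2_def)
  have "bij \<sigma>" and \<sigma>1: "\<sigma> 1 = 1" and \<sigma>add: "\<And>a b. \<sigma> (a + b) = \<sigma> a + \<sigma> b"
    using \<sigma> by (auto simp: field_automorphism_def)
  have \<sigma>0: "\<sigma> 0 = 0" using \<sigma>add[of 0 0] by (metis add.right_neutral add_left_cancel)
  have \<sigma>m: "\<sigma> (- 1) = - 1" using \<sigma>add[of 1 "- 1"] \<sigma>0 \<sigma>1 by (simp add: eq_neg_iff_add_eq_0 add.commute)
  have \<sigma>nz: "\<sigma> x = 0 \<longleftrightarrow> x = 0" for x using \<sigma>0 bij_is_inj[OF \<open>bij \<sigma>\<close>] by (metis injD)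
  have h': "\<sigma> h ^ (q ^ t + 1) = - 1"
    using field_automorphism_power_int[OF \<sigma>, of h "int (q ^ t + 1)"] h \<sigma>m
    by (simp only: power_int_of_nat)
  define e1 e2 where "e1 = f (vector [1, 0])" and "e2 = f (vector [0, 1])"
  define a b c d where "a = e1 $ 1" and "b = e2 $ 1" and "c = e1 $ 2" and "d = e2 $ 2"
  define l m where "l = (\<lambda>x. a * x + b * psi q t (\<sigma> h) x)" and "m = (\<lambda>x. c * x + d * psi q t (\<sigma> h) x)"
  have f_vec: "f (vector [x, y]) = vector [a * \<sigma> x + b * \<sigma> y, c * \<sigma> x + d * \<sigma> y]" for x y
  proof -
    have "vector [x, y] = x *s (vector [1, 0] :: 'a ^ 2) + y *s vector [0, 1]"
      by (simp add: vec_eq_iff forall_2 vector_2)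
    then have "f (vector [x, y]) = \<sigma> x *s e1 + \<sigma> y *s e2" by (simp add: fadd sc e1_def e2_def)
    then show ?thesis by (simp add: vec_eq_iff forall_2 vector_2 a_def b_def c_def d_def mult.commute)
  qed
  have Lk: "linset q t k = {proj_point (vector [l x, m x]) | x. x \<noteq> 0}"
  proof -
    have "linset q t h = (\<lambda>x. proj_point (vector [x, psi q t h x])) ` {x. x \<noteq> 0}"
      by (auto simp: linset_def)
    then have "linset q t k = (\<lambda>x. f ` proj_point (vector [x, psi q t h x])) ` {x. x \<noteq> 0}"
      unfolding fL by (simp only: image_image)
    also have "\<dots> = (\<lambda>x. proj_point (vector [l x, m x])) ` \<sigma> ` {x. x \<noteq> 0}"
      by (simp add: image_image semilinear_image_proj_point[OF \<sigma> sc] f_vec field_automorphism_psi[OF \<sigma>] l_def m_def)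
    also have "\<sigma> ` {x. x \<noteq> 0} = {x. x \<noteq> 0}"
      using bij_is_surj[OF \<open>bij \<sigma>\<close>] \<sigma>nz by (auto simp: image_iff)
    finally show ?thesis by auto
  qed
  have lin: "linearized l" "linearized m"
    unfolding l_def m_def using linearized_psi[OF h'] linearized_monomial[of _ 0]
      linearized_comp[of "\<lambda>x. b * Fr 0 x" "psi q t (\<sigma> h)"] linearized_comp[of "\<lambda>x. d * Fr 0 x" "psi q t (\<sigma> h)"]
    by (auto intro!: linearized_add)
  \<comment> \<open>No point of \<open>linset q t k\<close> has first coordinate 0; hence
    \<open>l\<close> has trivial kernel and is invertible.\<close>
  have sub: "l x \<noteq> 0 \<and> (\<exists>y. y \<noteq> 0 \<and> m x / l x = psi q t k y / y)" if "x \<noteq> 0" for x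
  proof -
    have "proj_point (vector [l x, m x]) \<in> linset q t k" using that Lk by auto
    then obtain y where "y \<noteq> 0" "proj_point (vector [l x, m x]) = proj_point (vector [y, psi q t k y])"
      by (auto simp: linset_def)
    then show ?thesis using proj_point_eqD[of "l x" "m x" y] by blast
  qed
  have sup: "\<exists>x. x \<noteq> 0 \<and> m x / l x = psi q t k y / y" if "y \<noteq> 0" for y
  proof -
    have "proj_point (vector [y, psi q t k y]) \<in> linset q t k" using that by (auto simp: linset_def)
    then obtain x where "x \<noteq> 0" "proj_point (vector [l x, m x]) = proj_point (vector [y, psi q t k y])"
      unfolding Lk by auto
    then show ?thesis using proj_point_eqD[of "l x" "m x" y] that by blast
  qed
  have l_diff: "l (x - y) = l x - l y" for x y
    using linearized_additive[OF lin(1), of "x - y" y] by simp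
  have "inj l"
    by (rule injI) (metis sub l_diff diff_self right_minus_eq)
  then have bl: "bij l" by (simp add: bij_betw_def finite_UNIV_inj_surj)
  define F where "F = (\<lambda>x. m (inv l x))"
  have Fl: "F (l x) = m x" for x using \<open>inj l\<close> by (simp add: F_def)
  have linF: "linearized F" unfolding F_def by (rule linearized_comp[OF lin(2) linearized_inv[OF lin(1) bl]])
  have l0: "l 0 = 0" using l_diff[of 0 0] by simp
  have "{F z / z | z. z \<noteq> 0} = {m x / l x | x. x \<noteq> 0}"
  proof (intro subset_antisym subsetI; clarsimp)
    fix z :: 'a assume "z \<noteq> 0"
    moreover obtain x where "z = l x" using bij_is_surj[OF bl] by (metis surjD)
    ultimately show "\<exists>x. F z / z = m x / l x \<and> x \<noteq> 0" using Fl l0 by auto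
  next
    fix x :: 'a assume "x \<noteq> 0"
    then show "\<exists>z. m x / l x = F z / z \<and> z \<noteq> 0" using sub Fl by metis
  qed
  also have "\<dots> = {psi q t k y / y | y. y \<noteq> 0}"
  proof (intro subset_antisym subsetI; clarsimp)
    fix x :: 'a assume "x \<noteq> 0"
    then show "\<exists>y. m x / l x = psi q t k y / y \<and> y \<noteq> 0" using sub by metis
  next
    fix y :: 'a assume "y \<noteq> 0"
    then show "\<exists>x. psi q t k y / y = m x / l x \<and> x \<noteq> 0" using sup by metis
  qed
  finally have same: "{F z / z | z. z \<noteq> 0} = {psi q t k y / y | y. y \<noteq> 0}" .
  have "e2 \<noteq> 0"
  proof
    assume "e2 = 0"
    moreover have "f 0 = 0" using fadd[of 0 0] by simp
    ultimately have "vector [0, 1] = (0 :: 'a ^ 2)" using bij_is_inj[OF \<open>bij f\<close>] unfolding e2_def by (metis injD)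
    then show False by (metis vector_2(2) zero_index zero_neq_one)
  qed
  then have bd: "b \<noteq> 0 \<or> d \<noteq> 0" by (auto simp: b_def d_def vec_eq_iff forall_2)
  have "k ^ 2 * Fr 2 k ^ 2 = \<sigma> h ^ 2 * Fr 2 (\<sigma> h) ^ 2"
    by (rule linear_equivalence_condition[OF h' k linF same _ bd]) (use Fl in \<open>simp add: l_def m_def\<close>)
  then show ?thesis using that \<sigma> h' by blast
qed

section \<open>Counting parameters in an equivalence class\<close>

text \<open>By counting, \<open>h\<close> is a root of a nonzero polynomial of degree at most \<open>2rt\<close> over the prime
  field, and automorphisms permute its roots.\<close>

lemma card_automorphism_orbit_le:
  fixes h :: 'a
  shows "card {\<sigma> h | \<sigma>. field_automorphism \<sigma>} \<le> 2 * r * t"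
proof -
  let ?n = "2 * r * t"
  let ?C = "PiE {..?n} (\<lambda>_. {..<p})"
  let ?g = "\<lambda>c. \<Sum>i\<le>?n. of_nat (c i) * h ^ i :: 'a"
  have p: "p > 1" using prime_p prime_gt_1_nat by blast
  have "CARD('a) = p ^ ?n" by (simp add: card_UNIV q_power mult_ac)
  moreover have "card ?C = p ^ Suc ?n" by (simp add: card_PiE)
  moreover have "p ^ ?n < p ^ Suc ?n" using p by (intro power_strict_increasing) auto
  moreover have "card (?g ` ?C) \<le> CARD('a)" by (rule card_mono) simp_all
  ultimately have "card (?g ` ?C) < card ?C" by linarith
  \<comment> \<open>There are more coefficient vectors than field elements, so two of them give the
    same value at \<open>h\<close>; their difference is the polynomial \<open>P\<close>.\<close>
  then have "\<not> inj_on ?g ?C" using card_image by force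
  then obtain c c' where c: "c \<in> ?C" "c' \<in> ?C" "c \<noteq> c'" "?g c = ?g c'" by (auto simp: inj_on_def)
  define P where "P = (\<Sum>i\<le>?n. monom (of_nat (c i) - of_nat (c' i) :: 'a) i)"
  have coeff: "coeff P i = (if i \<le> ?n then of_nat (c i) - of_nat (c' i) else 0)" for i
    by (simp add: P_def coeff_sum)
  obtain i where i: "i \<le> ?n" "c i \<noteq> c' i" using PiE_ext[OF c(1,2)] c(3) by auto
  have inj: "x = y" if "x < p" "y < p" "x \<le> y" "of_nat x = (of_nat y :: 'a)" for x y
  proof -
    have "of_nat (y - x) = (0 :: 'a)" using that by (simp add: of_nat_diff)
    then have "p dvd y - x" unfolding of_nat_eq_0_iff_char_dvd CHAR_eq .
    then show ?thesis using that by (auto dest: dvd_imp_le)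
  qed
  have "c i < p" "c' i < p" using c i by auto
  then have "coeff P i \<noteq> 0" using inj[of "c i" "c' i"] inj[of "c' i" "c i"] i coeff[of i] by force
  then have P0: "P \<noteq> 0" by auto
  have deg: "degree P \<le> ?n" by (rule degree_le) (simp add: coeff)
  have "\<sigma> h \<in> {x. poly P x = 0}" if \<sigma>: "field_automorphism \<sigma>" for \<sigma>
  proof -
    have one: "\<sigma> 1 = 1" and add: "\<And>a b. \<sigma> (a + b) = \<sigma> a + \<sigma> b"
      and mult: "\<And>a b. \<sigma> (a * b) = \<sigma> a * \<sigma> b"
      using \<sigma> by (auto simp: field_automorphism_def)
    have zero: "\<sigma> 0 = 0" using add[of 0 0] by (metis add.right_neutral add_left_cancel)
    have nat: "\<sigma> (of_nat x) = of_nat x" for x by (induction x) (simp_all add: zero one add)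
    have pow: "\<sigma> (y ^ m) = \<sigma> y ^ m" for y m by (induction m) (simp_all add: one mult)
    have sum: "\<sigma> (sum g A) = (\<Sum>x\<in>A. \<sigma> (g x))" for g and A :: "nat set"
      by (induction A rule: infinite_finite_induct) (simp_all add: zero add)
    have "(\<Sum>i\<le>?n. of_nat (c i) * \<sigma> h ^ i) = (\<Sum>i\<le>?n. of_nat (c' i) * \<sigma> h ^ i)"
      using arg_cong[OF c(4), of \<sigma>] by (simp add: sum mult nat pow)
    then show ?thesis by (simp add: P_def poly_sum poly_monom left_diff_distrib sum_subtractf)
  qed
  then have "card {\<sigma> h | \<sigma>. field_automorphism \<sigma>} \<le> card {x. poly P x = 0}"
    by (intro card_mono) auto
  also have "\<dots> \<le> degree P" by (rule card_poly_roots_bound[OF P0])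
  finally show ?thesis using deg by linarith
qed

text \<open>The nonzero elements, \<open>(q ^ t + 1) * (q ^ t - 1)\<close> in number, spread over at
  most \<open>q ^ t - 1\<close> norm values with at most \<open>q ^ t + 1\<close> in each fibre. So
  each fibre must be full; \<open>- 1\<close> is a possible value because \<open>q ^ t - 1\<close>
  is even.\<close>

lemma card_norm_eq_minus_1: "card {h :: 'a. h ^ (q ^ t + 1) = - 1} \<ge> q ^ t + 1"
proof -
  let ?R = "{c :: 'a. c ^ (q ^ t - 1) = 1}" and ?N = "\<lambda>c. {h :: 'a. h ^ (q ^ t + 1) = c}"
  have qt: "q ^ t \<ge> 3" using q_ge self_le_power[of q t] t_gt by linarith
  have "q ^ (2 * t) = q ^ t * q ^ t" by (simp only: mult_2 power_add)
  then have prod: "CARD('a) - 1 = (q ^ t + 1) * (q ^ t - 1)"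
    by (simp add: card_UNIV algebra_simps)
  have "odd (q ^ t)" using odd_p by (simp add: q_power)
  then have R1: "- 1 \<in> ?R" using qt by simp
  have "- {0} \<subseteq> (\<Union>c\<in>?R. ?N c)"
  proof
    fix x :: 'a assume "x \<in> - {0}"
    then have "(x ^ (q ^ t + 1)) ^ (q ^ t - 1) = 1"
      using power_CARD_minus_1[of x] unfolding prod power_mult by simp
    then show "x \<in> (\<Union>c\<in>?R. ?N c)" by blast
  qed
  then have "card (- {0 :: 'a}) \<le> card (\<Union>c\<in>?R. ?N c)" by (intro card_mono) auto
  also have "\<dots> \<le> (\<Sum>c\<in>?R. card (?N c))" by (rule card_UN_le) simp
  also have "\<dots> = card (?N (- 1)) + (\<Sum>c\<in>?R - {- 1}. card (?N c))"
    using R1 by (subst sum.remove[of _ "- 1"]) auto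
  also have "(\<Sum>c\<in>?R - {- 1}. card (?N c)) \<le> (\<Sum>c\<in>?R - {- 1}. q ^ t + 1)"
    by (intro sum_mono card_roots_power_le) simp
  also have "\<dots> = (card ?R - 1) * (q ^ t + 1)" using R1 by simp
  also have "\<dots> \<le> (q ^ t - 1 - 1) * (q ^ t + 1)"
    using card_roots_power_le[of "q ^ t - 1" "1 :: 'a"] qt by (intro mult_right_mono diff_le_mono) auto
  finally have "(q ^ t + 1) * (q ^ t - 1) \<le> card (?N (- 1)) + (q ^ t - 1 - 1) * (q ^ t + 1)"
    by (simp only: card_Compl_0 prod)
  moreover have "(q ^ t + 1) * (q ^ t - 1) = (q ^ t - 1 - 1) * (q ^ t + 1) + (q ^ t + 1)"
  proof -
    have "q ^ t - 1 = Suc (q ^ t - 1 - 1)" using qt by simp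
    then show ?thesis by (metis add.commute mult.commute mult_Suc)
  qed
  ultimately show ?thesis by linarith
qed

text \<open>Every parameter in the class of \<open>h\<close> is an element of \<open>Z\<close> times
  a conjugate of \<open>h\<close>, so a class takes at most \<open>2 * r * t * card Z\<close> of the
  parameters.\<close>

lemma num_inequivalent_bound:
  fixes Z :: "'a set"
  assumes Z: "\<And>g k. g ^ (q ^ t + 1) = - 1 \<Longrightarrow> k ^ (q ^ t + 1) = - 1 \<Longrightarrow>
    k ^ 2 * Fr 2 k ^ 2 = g ^ 2 * Fr 2 g ^ 2 \<Longrightarrow> k / g \<in> Z"
  shows "q ^ t + 1 \<le> num_inequivalent {linset q t h | h :: 'a. h ^ (q ^ t + 1) = - 1} * (2 * r * t * card Z)"
proof -
  let ?H = "{h :: 'a. h ^ (q ^ t + 1) = - 1}"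
  let ?c = "\<lambda>h :: 'a. PGammaL2_rel `` {linset q t h}"
  have quot: "{linset q t h | h. h \<in> ?H} // PGammaL2_rel = ?c ` ?H"
    by (auto simp: quotient_def)
  have fibre: "card {k \<in> ?H. ?c k = C} \<le> 2 * r * t * card Z" if "C \<in> ?c ` ?H" for C
  proof -
    obtain h where h: "h \<in> ?H" "C = ?c h" using \<open>C \<in> ?c ` ?H\<close> by auto
    have h0: "h \<noteq> 0" using h by auto
    let ?O = "{\<sigma> h | \<sigma>. field_automorphism \<sigma>}"
    have "{k \<in> ?H. ?c k = C} \<subseteq> (\<lambda>(g, z). z * g) ` (?O \<times> Z)"
    proof
      fix k assume k: "k \<in> {k \<in> ?H. ?c k = C}"
      have "linset q t k \<in> Pow PG1" using linset_subset_PG1 by blast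
      then have "(linset q t h, linset q t k) \<in> PGammaL2_rel"
        using k h eq_equiv_class[OF _ equiv_PGammaL2_rel] by auto
      then obtain \<sigma> where \<sigma>: "field_automorphism \<sigma>" "\<sigma> h ^ (q ^ t + 1) = - 1"
        "k ^ 2 * Fr 2 k ^ 2 = \<sigma> h ^ 2 * Fr 2 (\<sigma> h) ^ 2"
        using linset_equivalent_imp h k by (metis (mono_tags, lifting) mem_Collect_eq)
      have "\<sigma> h \<noteq> 0" using \<sigma>(2) by auto
      moreover have "k / \<sigma> h \<in> Z" using Z \<sigma> k by blast
      ultimately show "k \<in> (\<lambda>(g, z). z * g) ` (?O \<times> Z)"
        using \<sigma>(1) by (auto intro!: image_eqI[of _ _ "(\<sigma> h, k / \<sigma> h)"])
    qed
    then have "card {k \<in> ?H. ?c k = C} \<le> card ((\<lambda>(g, z). z * g) ` (?O \<times> Z))"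
      by (intro card_mono) auto
    also have "\<dots> \<le> card (?O \<times> Z)" by (intro card_image_le) auto
    also have "\<dots> \<le> 2 * r * t * card Z"
      unfolding card_cartesian_product by (intro mult_right_mono card_automorphism_orbit_le) simp
    finally show ?thesis .
  qed
  have "q ^ t + 1 \<le> card ?H" by (rule card_norm_eq_minus_1)
  also have "card ?H = (\<Sum>C\<in>?c ` ?H. card {k \<in> ?H. ?c k = C})"
    unfolding card_eq_sum by (rule sum.image_gen) simp
  also have "\<dots> \<le> card (?c ` ?H) * (2 * r * t * card Z)"
    using sum_bounded_above[of "?c ` ?H", OF fibre] by simp
  finally show ?thesis using quot by (simp add: num_inequivalent_def)
qed

end

theorem theorem5p1:
  fixes p r t q n M :: nat
  assumes "prime p" and "odd p" and "r > 0" and "t > 4"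
    and "q = p ^ r" and "n = 2 * t"
    and "CARD('a::{field,finite}) = q ^ n"
    and "M = num_inequivalent {linset q t h | h :: 'a. h ^ (q ^ t + 1) = -1}"
  shows "int M \<ge>
    (if t mod 4 \<noteq> 2
     then \<lfloor>real (q ^ t + 1) / real (8 * r * t)\<rfloor>
     else \<lfloor>real (q ^ t + 1) / real (4 * r * t * (q ^ 2 + 1))\<rfloor>)"
proof -
  interpret linset_field p r t q "TYPE('a)"
    by unfold_locales (use assms in simp_all)
  have floor: "\<lfloor>real x / real B\<rfloor> \<le> int M" if "x \<le> M * B" "B > 0" for x B
  proof -
    have "real x \<le> real M * real B" using that(1) by (metis of_nat_le_iff of_nat_mult)
    then have "real x / real B \<le> real M" using that(2) by (simp add: divide_le_eq)
    then show ?thesis by linarith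
  qed
  show ?thesis
  proof (cases "t mod 4 = 2")
    case True
    \<comment> \<open>The ratios allowed by \<open>ratio_power_eq_1\<close>; for other residues of
      \<open>t\<close> modulo 4, \<open>fourth_power_eq_1\<close> permits the smaller set of fourth
      roots of unity.\<close>
    let ?Z = "{x :: 'a. x ^ (2 * (q ^ 2 + 1)) = 1}"
    have "q ^ t + 1 \<le> M * (2 * r * t * card ?Z)"
      unfolding assms(8) by (rule num_inequivalent_bound) (use ratio_power_eq_1 in blast)
    also have "\<dots> \<le> M * (2 * r * t * (2 * (q ^ 2 + 1)))"
      by (intro mult_left_mono card_roots_power_le) simp_all
    also have "2 * r * t * (2 * (q ^ 2 + 1)) = 4 * r * t * (q ^ 2 + 1)" by simp
    finally have "\<lfloor>real (q ^ t + 1) / real (4 * r * t * (q ^ 2 + 1))\<rfloor> \<le> int M"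
      by (rule floor) (use assms(3,4) in simp)
    then show ?thesis by (simp only: True simp_thms if_False)
  next
    case False
    let ?Z = "{x :: 'a. x ^ 4 = 1}"
    have "q ^ t + 1 \<le> M * (2 * r * t * card ?Z)"
      unfolding assms(8) by (rule num_inequivalent_bound) (use fourth_power_eq_1 False in blast)
    also have "\<dots> \<le> M * (2 * r * t * 4)"
      by (intro mult_left_mono card_roots_power_le) simp_all
    also have "2 * r * t * 4 = 8 * r * t" by simp
    finally have "\<lfloor>real (q ^ t + 1) / real (8 * r * t)\<rfloor> \<le> int M"
      by (rule floor) (use assms(3,4) in simp)
    then show ?thesis by (simp only: False simp_thms if_True)
  qed
qed

end
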